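(* Let $\delta$ be an associative algebra structure on $W$ and let $M$ be a module over $W$ with module structure $\lambda$ and multiplication $\mu$. The infinitesimal deformations of the module $M$ with multiplication $\mu$ over the associative algebra $\delta$, allowing the algebra structure $\delta$ on $W$ and the module structure $\lambda$ to vary (with $\mu$ fixed), are classified up to infinitesimal equivalence by 1. $D_\delta$-cohomology classes of $D_\delta$-cocycles $\delta_1\in C^2$ satisfying the condition $[D_{\bar\lambda}(\bar\delta_1)]=0$; 2. $D_{\bar\delta+\bar\lambda}$-cohomology classes $[\bar\tau]$ of $D_{\bar\delta+\bar\lambda}$-cocycles $\bar\tau$ of $D_\mu$-cocycles $\tau\in C^{1,1}$. That is: the $D_\delta$-cohomology class of $\delta_1$ is an invariant of the equivalence class of the deformation $d+t(\delta_1+\lambda_1)$; a $D_\delta$-cocycle $\delta_1$ occurs in a deformation if and only if $[D_{\bar\lambda}(\bar\delta_1)]=0$, a condition depending only on the class of $\delta_1$; and for each such class, fixing a representative $\delta_1$ and one $\lambda_1$ such that $\delta_1,\lambda_1$ determine a deformation, the map $[\bar\tau]\mapsto d+t(\delta_1+\lambda_1+\tau)$ induces a bijection from the set of classes $[\bar\tau]$ in 2 to the set of infinitesimal equivalence classes of deformations whose $C^2$-component lies in the class of $\delta_1$.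
   Context: Work over a field $\mathbb K$ of characteristic different from 2 and 3. $M,W$ are $\mathbb Z_2$-graded vector spaces and $V=M\oplus W$ (parity-reversed convention: an ordinary ungraded algebra corresponds to a completely odd space). Let $C(V)=\operatorname{Hom}(T(V),V)$, $T(V)=\bigoplus_n V^{\otimes n}$. For $\varphi\in\operatorname{Hom}(V^{\otimes k},V)$ and $\chi\in\operatorname{Hom}(V^{\otimes l},V)$ put $$(\varphi\circ\chi)(v_1,\dots,v_{k+l-1})=\sum_i(-1)^{|\chi|(|v_1|+\dots+|v_{i-1}|)}\varphi(v_1,\dots,v_{i-1},\chi(v_i,\dots,v_{i+l-1}),\dots,v_{k+l-1}),$$ and $[\varphi,\chi]=\varphi\circ\chi-(-1)^{|\varphi||\chi|}\chi\circ\varphi$ (the graded Lie bracket of coderivations of $T(V)$). Maps defined on a summand of $T(V)$ are extended by zero; $D_\alpha=[\alpha,\cdot\,]$. An odd $d\in\operatorname{Hom}(V^{\otimes2},V)$ is an associative algebra structure iff $[d,d]=0$. Let $T^{k,l}(M,W)\subseteq V^{\otimes(k+l)}$ be spanned by tensors of $k$ elements of $M$ and $l$ elements of $W$ in any order, $C^{k,l}=\operatorname{Hom}(T^{k,l}(M,W),M)$, and $C^k=\operatorname{Hom}(W^{\otimes k},W)$. In this setting only $C^n$ and $C^{k,l}$ with $k\ge1$ are used as cochains. Setting: odd cochains $\delta\in C^2$, $\mu\in C^{2,0}$, $\lambda\in C^{1,1}$ with $[\delta,\delta]=0$, $[\mu,\mu]=0$, $[\delta,\lambda]+\tfrac12[\lambda,\lambda]=0$,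 $[\mu,\lambda]=0$; $d=\delta+\mu+\lambda$ (an extension of $W$ by $M$ with zero cocycle part in $\operatorname{Hom}(W^{\otimes 2},M)$; "module" means bimodule with this compatibility with $\mu$). An infinitesimal deformation allowing $\delta,\lambda$ to vary is $d_t=d+t(\delta_1+\lambda_1)$, $t^2=0$, with odd $\delta_1\in C^2$, $\lambda_1\in C^{1,1}$ and $[d_t,d_t]=0$; equivalently $[\delta,\delta_1]=0$, $[\lambda,\delta_1]+[\delta+\lambda,\lambda_1]=0$, $[\mu,\lambda_1]=0$. Two such deformations are infinitesimally equivalent if $d_t'=\exp(t(\alpha+\gamma))^*(d_t)$ for some even $\alpha\in C^{1,0}=\operatorname{Hom}(M,M)$, $\gamma\in C^1=\operatorname{Hom}(W,W)$, where $f^*(d)=f^{-1}\circ d\circ (f\otimes f)$; explicitly $\delta_1'=\delta_1+D_\delta(\gamma)$, $\lambda_1'=\lambda_1+D_\lambda(\alpha+\gamma)$, $D_\mu(\alpha+\gamma)=0$ (so $D_\mu(\alpha)=0$). Cohomology: $D_\delta:C^n\to C^{n+1}$, $D_\lambda:C^n\to C^{1,n}$, $D_{\delta+\lambda}:C^{k,l}\to C^{k,l+1}$, $D_\mu:C^{k,l}\to C^{k+1,l}$, and $D_\mu(C^n)=0$. The bar denotes $D_\mu$-cohomology classes, where (since $C^{0,l}$ is excluded) no nonzero element of $C^n$ or $C^{1,l}$ is a $D_\mu$-coboundary; $D_{\bar\alpha}(\bar\varphi)=\overline{[\alpha,\varphi]}$. - Classes in 1 are modulo $D_\delta(\gamma)$,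 $\gamma\in C^1$ even. The condition $[D_{\bar\lambda}(\bar\delta_1)]=0$ refers to the $D_{\bar\delta+\bar\lambda}$-cohomology on the complex of $C^{k,l}$, $k\ge1$: it means that there is an odd $\lambda_1\in C^{1,1}$ with $D_\mu(\lambda_1)=0$ and $D_{\delta+\lambda}(\lambda_1)=-D_\lambda(\delta_1)$. - In 2, $\tau\in C^{1,1}$ is odd with $D_\mu(\tau)=0$ and $D_{\delta+\lambda}(\tau)=0$, and $[\bar\tau]=[\bar\tau']$ iff $\tau'-\tau=D_{\delta+\lambda}(\alpha+\gamma)$ for some even $\alpha\in C^{1,0}$, $\gamma\in C^1$ with $D_\mu(\alpha)=0$ and $D_\delta(\gamma)=0$. *)

theory Defs
  imports "HOL-Analysis.Product_Vector" "HOL-Library.Function_Algebras" "HOL-Library.Z2"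
begin

section \<open>Graded vector spaces\<close>

locale graded_vector_space = vector_space scale
  for scale :: "'k::field \<Rightarrow> 'v::ab_group_add \<Rightarrow> 'v" +
  fixes G :: "bit \<Rightarrow> 'v set"
  assumes subspace_G: "\<And>p. subspace (G p)"
    and decomposition: "\<And>v. \<exists>!(a, b). a \<in> G 0 \<and> b \<in> G 1 \<and> v = a + b"

definition sum_grading :: "(bit \<Rightarrow> 'a set) \<Rightarrow> (bit \<Rightarrow> 'b set) \<Rightarrow> bit \<Rightarrow> ('a \<times> 'b) set" where
  "sum_grading G H p = G p \<times> H p"

definition signed :: "bit \<Rightarrow> 'v::ab_group_add \<Rightarrow> 'v" where
  "signed p v = (if p = 1 then - v else v)"

text \<open>The linear map that sends a homogeneous \<open>v\<close> to \<open>(-1)^(q |v|) v\<close>.\<close>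

definition koszul :: "(bit \<Rightarrow> 'v::ab_group_add set) \<Rightarrow> bit \<Rightarrow> 'v \<Rightarrow> 'v" where
  "koszul G q v = (THE u. \<exists>a\<in>G 0. \<exists>b\<in>G 1. v = a + b \<and> u = a + signed q b)"

section \<open>Cochains and the bracket\<close>

text \<open>
  An element of \<open>Hom(T(V), V)\<close> is a function on lists that is multilinear in the entries of lists
  of each fixed length. Extending a map defined on a summand of \<open>T(V)\<close> by zero means that it
  vanishes on all other lists.
\<close>

type_synonym 'v cochain = "'v list \<Rightarrow> 'v"

definition cochains :: "('k::field \<Rightarrow> 'v::ab_group_add \<Rightarrow> 'v) \<Rightarrow> 'v cochain set" where
  "cochains s = {\<phi>. \<forall>us vs. Vector_Spaces.linear s s (\<lambda>v. \<phi> (us @ v # vs))}"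

definition has_parity :: "(bit \<Rightarrow> 'v::ab_group_add set) \<Rightarrow> bit \<Rightarrow> 'v cochain \<Rightarrow> bool" where
  "has_parity G p \<phi> \<longleftrightarrow>
     (\<forall>ps vs. list_all2 (\<lambda>q v. v \<in> G q) ps vs \<longrightarrow> \<phi> vs \<in> G (p + sum_list ps))"

abbreviation "even_cochain G \<equiv> has_parity G 0"
abbreviation "odd_cochain G \<equiv> has_parity G 1"

text \<open>
  The homogeneous component of parity \<open>q\<close> of a cochain (characteristic different from 2):
  conjugation with the grading involution multiplies a cochain of parity \<open>p\<close> by \<open>(-1)^p\<close>.
\<close>

definition parity_part ::
  "('k::field \<Rightarrow> 'v::ab_group_add \<Rightarrow> 'v) \<Rightarrow> (bit \<Rightarrow> 'v set) \<Rightarrow> bit \<Rightarrow> 'v cochain \<Rightarrow> 'v cochain" where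
  "parity_part s G q \<phi> =
     (\<lambda>vs. s (1/2) (\<phi> vs + signed q (koszul G 1 (\<phi> (map (koszul G 1) vs)))))"

text \<open>
  The composition \<open>\<phi> \<circ> \<chi>\<close> for \<open>\<chi>\<close> of parity \<open>q\<close>. The sign \<open>(-1)^(|\<chi>| (|v\<^sub>1| + \<dots> + |v\<^sub>i|))\<close> is
  produced by applying \<open>koszul G q\<close> to the arguments in front of \<open>\<chi>\<close>, so that the formula makes
  sense for inhomogeneous arguments. The summand for \<open>l\<close> belongs to the component of \<open>\<chi>\<close> on the
  \<open>l\<close>-th tensor power.
\<close>

definition insertion ::
  "(bit \<Rightarrow> 'v::ab_group_add set) \<Rightarrow> bit \<Rightarrow> 'v cochain \<Rightarrow> 'v cochain \<Rightarrow> 'v cochain" where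
  "insertion G q \<phi> \<chi> = (\<lambda>vs. \<Sum>l\<le>length vs. \<Sum>i\<le>length vs - l.
     \<phi> (map (koszul G q) (take i vs) @ \<chi> (take l (drop i vs)) # drop (i + l) vs))"

text \<open>
  \<open>[\<phi>, \<chi>] = \<phi> \<circ> \<chi> - (-1)^(|\<phi>| |\<chi>|) \<chi> \<circ> \<phi>\<close> for homogeneous cochains, extended bilinearly.
\<close>

definition bracket ::
  "('k::field \<Rightarrow> 'v::ab_group_add \<Rightarrow> 'v) \<Rightarrow> (bit \<Rightarrow> 'v set) \<Rightarrow> 'v cochain \<Rightarrow> 'v cochain \<Rightarrow> 'v cochain"
where
  "bracket s G \<phi> \<chi> = (\<lambda>vs. \<Sum>p\<in>{0, 1}. \<Sum>q\<in>{0, 1}.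
     insertion G q (parity_part s G p \<phi>) (parity_part s G q \<chi>) vs
     - signed (p * q) (insertion G p (parity_part s G q \<chi>) (parity_part s G p \<phi>) vs))"

section \<open>The spaces $C^{k,l}$ and $C^n$\<close>

text \<open>
  Here \<open>V = M \<oplus> W\<close> is the type \<open>'m \<times> 'w\<close>, with \<open>M = UNIV \<times> {0}\<close> and \<open>W = {0} \<times> UNIV\<close>.
  \<open>mixed_hom s k l U\<close> is \<open>Hom(T\<^sup>k\<^sup>,\<^sup>l(M, W), U)\<close>, extended by zero to the tensors of any other type.
\<close>

definition summand :: "bool \<Rightarrow> ('m::zero \<times> 'w::zero) set" where
  "summand inM = (if inM then UNIV \<times> {0} else {0} \<times> UNIV)"

definition mixed_hom ::
  "('k::field \<Rightarrow> 'm::ab_group_add \<times> 'w::ab_group_add \<Rightarrow> 'm \<times> 'w) \<Rightarrow> nat \<Rightarrow> nat \<Rightarrow> ('m \<times> 'w) set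
   \<Rightarrow> ('m \<times> 'w) cochain set" where
  "mixed_hom s k l U = {\<phi> \<in> cochains s. (\<forall>vs. \<phi> vs \<in> U) \<and>
     (\<forall>bs vs. list_all2 (\<lambda>b v. v \<in> summand b) bs vs
        \<and> (count_list bs True, count_list bs False) \<noteq> (k, l) \<longrightarrow> \<phi> vs = 0)}"

definition CM ::
  "('k::field \<Rightarrow> 'm::ab_group_add \<times> 'w::ab_group_add \<Rightarrow> 'm \<times> 'w) \<Rightarrow> nat \<Rightarrow> nat
   \<Rightarrow> ('m \<times> 'w) cochain set" where
  "CM s k l = mixed_hom s k l (summand True)"

definition CW ::
  "('k::field \<Rightarrow> 'm::ab_group_add \<times> 'w::ab_group_add \<Rightarrow> 'm \<times> 'w) \<Rightarrow> nat
   \<Rightarrow> ('m \<times> 'w) cochain set" where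
  "CW s n = mixed_hom s 0 n (summand False)"

section \<open>Infinitesimal deformations\<close>

text \<open>
  \<open>V[t]/(t\<^sup>2)\<close> is the graded vector space \<open>V \<times> V\<close>, where \<open>(v, w)\<close> stands for \<open>v + t w\<close>.
  \<open>infinitesimal \<phi> \<phi>\<^sub>1\<close> is the \<open>t\<close>-multilinear extension of \<open>\<phi> + t \<phi>\<^sub>1\<close> to \<open>V[t]/(t\<^sup>2)\<close>.
\<close>

abbreviation dual_scale ::
  "('k::field \<Rightarrow> 'v::ab_group_add \<Rightarrow> 'v) \<Rightarrow> 'k \<Rightarrow> 'v \<times> 'v \<Rightarrow> 'v \<times> 'v" where
  "dual_scale s \<equiv> module_prod.scale s s"

abbreviation dual_grading :: "(bit \<Rightarrow> 'v set) \<Rightarrow> bit \<Rightarrow> ('v \<times> 'v) set" where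
  "dual_grading G \<equiv> sum_grading G G"

definition infinitesimal ::
  "'v::ab_group_add cochain \<Rightarrow> 'v cochain \<Rightarrow> ('v \<times> 'v) cochain" where
  "infinitesimal \<phi> \<phi>\<^sub>1 = (\<lambda>xs. (\<phi> (map fst xs),
     \<phi>\<^sub>1 (map fst xs) + (\<Sum>i<length xs. \<phi> ((map fst xs)[i := snd (xs ! i)]))))"

text \<open>\<open>exp(t \<beta>) = 1 + t \<beta>\<close>, since \<open>t\<^sup>2 = 0\<close>.\<close>

definition exp_t :: "'v::ab_group_add cochain \<Rightarrow> 'v \<times> 'v \<Rightarrow> 'v \<times> 'v" where
  "exp_t \<beta> = (\<lambda>(v, w). (v, w + \<beta> [v]))"

definition pullback :: "('v \<Rightarrow> 'v) \<Rightarrow> 'v cochain \<Rightarrow> 'v cochain" where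
  "pullback f d = (\<lambda>vs. inv f (d (map f vs)))"

text \<open>
  The deformation \<open>d + t (\<delta>\<^sub>1 + \<Lambda>\<^sub>1)\<close> of \<open>d = \<delta> + \<mu> + \<Lambda>\<close> is represented by the pair \<open>(\<delta>\<^sub>1, \<Lambda>\<^sub>1)\<close>.
  The module structure is called \<open>\<Lambda>\<close>, because lower case lambda is reserved for abstraction.
\<close>

definition deformations where
  "deformations s G \<delta> \<mu> \<Lambda> = {(\<delta>\<^sub>1, \<Lambda>\<^sub>1).
     \<delta>\<^sub>1 \<in> CW s 2 \<and> odd_cochain G \<delta>\<^sub>1 \<and> \<Lambda>\<^sub>1 \<in> CM s 1 1 \<and> odd_cochain G \<Lambda>\<^sub>1 \<and>
     (let d\<^sub>t = infinitesimal (\<delta> + \<mu> + \<Lambda>) (\<delta>\<^sub>1 + \<Lambda>\<^sub>1)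
      in bracket (dual_scale s) (dual_grading G) d\<^sub>t d\<^sub>t = 0)}"

definition inf_equivalence where
  "inf_equivalence s G \<delta> \<mu> \<Lambda> = {((\<delta>\<^sub>1, \<Lambda>\<^sub>1), (\<delta>\<^sub>1', \<Lambda>\<^sub>1')).
     (\<delta>\<^sub>1, \<Lambda>\<^sub>1) \<in> deformations s G \<delta> \<mu> \<Lambda> \<and> (\<delta>\<^sub>1', \<Lambda>\<^sub>1') \<in> deformations s G \<delta> \<mu> \<Lambda> \<and>
     (\<exists>\<alpha>\<in>CM s 1 0. \<exists>\<gamma>\<in>CW s 1. even_cochain G \<alpha> \<and> even_cochain G \<gamma> \<and>
        infinitesimal (\<delta> + \<mu> + \<Lambda>) (\<delta>\<^sub>1' + \<Lambda>\<^sub>1') =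
        pullback (exp_t (\<alpha> + \<gamma>)) (infinitesimal (\<delta> + \<mu> + \<Lambda>) (\<delta>\<^sub>1 + \<Lambda>\<^sub>1)))}"

section \<open>Cohomology\<close>

definition delta_cocycles where
  "delta_cocycles s G \<delta> = {\<delta>\<^sub>1 \<in> CW s 2. odd_cochain G \<delta>\<^sub>1 \<and> bracket s G \<delta> \<delta>\<^sub>1 = 0}"

definition delta_cohomologous where
  "delta_cohomologous s G \<delta> = {(\<delta>\<^sub>1, \<delta>\<^sub>1').
     \<delta>\<^sub>1 \<in> delta_cocycles s G \<delta> \<and> \<delta>\<^sub>1' \<in> delta_cocycles s G \<delta> \<and>
     (\<exists>\<gamma>\<in>CW s 1. even_cochain G \<gamma> \<and> \<delta>\<^sub>1' = \<delta>\<^sub>1 + bracket s G \<delta> \<gamma>)}"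

text \<open>
  \<open>mu_class s G \<mu> k l \<phi>\<close> is the \<open>D\<^sub>\<mu>\<close>-cohomology class of \<open>\<phi> \<in> C\<^sup>k\<^sup>,\<^sup>l\<close> in the complex with \<open>k \<ge> 1\<close>:
  as \<open>C\<^sup>0\<^sup>,\<^sup>l\<close> is excluded, the only coboundary in \<open>C\<^sup>1\<^sup>,\<^sup>l\<close> is zero.
\<close>

definition mu_coboundaries where
  "mu_coboundaries s G \<mu> k l = (if k \<le> 1 then {0} else bracket s G \<mu> ` CM s (k - 1) l)"

definition mu_class where
  "mu_class s G \<mu> k l \<phi> = {\<phi> + \<beta> | \<beta>. \<beta> \<in> mu_coboundaries s G \<mu> k l}"

text \<open>
  The vanishing of the class of \<open>D\<^sub>\<Lambda>(\<delta>\<^sub>1)\<close> in the cohomology of \<open>D\<^sub>\<delta>\<^sub>+\<^sub>\<Lambda>\<close> on \<open>D\<^sub>\<mu>\<close>-cohomology.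
\<close>

definition obstruction_vanishes where
  "obstruction_vanishes s G \<delta> \<mu> \<Lambda> \<delta>\<^sub>1 \<longleftrightarrow>
     (\<exists>\<Lambda>\<^sub>1\<in>CM s 1 1. odd_cochain G \<Lambda>\<^sub>1 \<and> bracket s G \<mu> \<Lambda>\<^sub>1 = 0 \<and>
        mu_class s G \<mu> 1 2 (bracket s G (\<delta> + \<Lambda>) \<Lambda>\<^sub>1) = mu_class s G \<mu> 1 2 (- bracket s G \<Lambda> \<delta>\<^sub>1))"

text \<open>
  Representatives \<open>\<tau>\<close> of the \<open>D\<^sub>\<delta>\<^sub>+\<^sub>\<Lambda>\<close>-cocycles in the \<open>D\<^sub>\<mu>\<close>-cohomology, the cocycles themselves,
  and the relation of being cohomologous, in which \<open>\<gamma> \<in> C\<^sup>1\<close> with \<open>D\<^sub>\<delta>(\<gamma>) = 0\<close> is admitted besides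
  \<open>\<alpha> \<in> C\<^sup>1\<^sup>,\<^sup>0\<close>.
\<close>

definition tau_cocycles where
  "tau_cocycles s G \<delta> \<mu> \<Lambda> = {\<tau> \<in> CM s 1 1. odd_cochain G \<tau> \<and> bracket s G \<mu> \<tau> = 0 \<and>
     mu_class s G \<mu> 1 2 (bracket s G (\<delta> + \<Lambda>) \<tau>) = mu_class s G \<mu> 1 2 0}"

definition tau_bar_cocycles where
  "tau_bar_cocycles s G \<delta> \<mu> \<Lambda> = mu_class s G \<mu> 1 1 ` tau_cocycles s G \<delta> \<mu> \<Lambda>"

definition tau_bar_cohomologous where
  "tau_bar_cohomologous s G \<delta> \<mu> \<Lambda> = {(mu_class s G \<mu> 1 1 \<tau>, mu_class s G \<mu> 1 1 \<tau>') | \<tau> \<tau>'.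
     \<tau> \<in> tau_cocycles s G \<delta> \<mu> \<Lambda> \<and> \<tau>' \<in> tau_cocycles s G \<delta> \<mu> \<Lambda> \<and>
     (\<exists>\<alpha>\<in>CM s 1 0. \<exists>\<gamma>\<in>CW s 1. even_cochain G \<alpha> \<and> even_cochain G \<gamma> \<and>
        bracket s G \<mu> \<alpha> = 0 \<and> bracket s G \<delta> \<gamma> = 0 \<and>
        mu_class s G \<mu> 1 1 (\<tau>' - \<tau>) = mu_class s G \<mu> 1 1 (bracket s G (\<delta> + \<Lambda>) (\<alpha> + \<gamma>)))}"

end

(*
  To first order in t, [d_t, d_t] = 0 says that delta_1 + lambda_1 is a D_d-cocycle, and conjugation by
  exp(t (alpha + gamma)) adds D_d(alpha + gamma) to it.  The components of these equations in the
  various C^k and C^{k,l} are independent, so the deformations form a group P of pairs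
  (delta_1, lambda_1), and infinitesimal equivalence is congruence modulo the group B of the pairs
  (D_delta(gamma), D_lambda(alpha + gamma)) with D_mu(alpha) = 0.  Since D_d D_d = 0, B is contained
  in P; this makes the obstruction depend on the class of delta_1 only, and it lets one move every
  deformation over the class of delta_1 to one over delta_1 itself.  The deformations over delta_1 are a
  coset of the tau with (0, tau) in P, and tau, tau' are cohomologous iff (0, tau' - tau) lies in B.
*)
theory Submission
  imports Defs
begin

section \<open>Quotients by differences\<close>

text \<open>Two obstacles shape the proof. Cochains are functions on arbitrary lists, whereas parity
  and membership in C^{k,l} are tested only on homogeneous lists, respectively on lists of elements
  of M or W. Equations are therefore reduced by multiadditivity to such lists, and components are
  told apart by counting how many entries come from M and from W. Deformations, moreover, are honest
  cochains on V[t]/(t^2), with the bracket of that space. There it is enough to know the parity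
  parts and the vanishing at a zero entry; the rest is a computation of the t-coefficient in arity 2
  or 3, in which associativity of d removes every term containing a t-part of an argument. The bars
  turn out to be harmless: in C^{1,l} the only D_mu-coboundary is zero, so the classes are
  singletons. They describe the elements of B whose first component is zero.\<close>

definition difference_relation :: "'a::ab_group_add set \<Rightarrow> 'a set \<Rightarrow> ('a \<times> 'a) set" where
  "difference_relation P B = {(x, y). x \<in> P \<and> y \<in> P \<and> y - x \<in> B}"

lemma equiv_difference_relation:
  assumes "0 \<in> B" "\<And>x y. x \<in> B \<Longrightarrow> y \<in> B \<Longrightarrow> x - y \<in> B"
  shows "equiv P (difference_relation P B)"
proof (rule equivI)
  show "difference_relation P B \<subseteq> P \<times> P" "refl_on P (difference_relation P B)"
    using assms(1) by (auto simp: difference_relation_def refl_on_def)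
  have neg: "- x \<in> B" if "x \<in> B" for x using assms(2)[OF assms(1) that] by simp
  show "sym (difference_relation P B)"
    using neg by (force simp: difference_relation_def intro!: symI)
  show "trans (difference_relation P B)"
  proof (rule transI)
    fix x y z assume "(x, y) \<in> difference_relation P B" "(y, z) \<in> difference_relation P B"
    then show "(x, z) \<in> difference_relation P B"
      using assms(2)[of "z - y" "- (y - x)"] neg[of "y - x"] by (simp add: difference_relation_def)
  qed
qed

text \<open>\<open>S\<close> is an equivalence on all of \<open>P\<close>, so \<open>Q // S\<close>
  consists of the full \<open>S\<close>-classes that meet \<open>Q\<close>. Accordingly
  \<open>surj\<close> asks to hit each element of \<open>Q\<close> only up to \<open>S\<close>. The
  explicit value of \<open>F\<close> on classes is kept in the conclusion, since the classification
  names the map and not just its existence.\<close>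

lemma quotient_bijection:
  assumes R: "equiv A R" and S: "equiv P S" and Q: "Q \<subseteq> P"
    and f: "\<And>x. x \<in> A \<Longrightarrow> f x \<in> Q"
    and iff: "\<And>x y. x \<in> A \<Longrightarrow> y \<in> A \<Longrightarrow> (x, y) \<in> R \<longleftrightarrow> (f x, f y) \<in> S"
    and surj: "\<And>q. q \<in> Q \<Longrightarrow> \<exists>x\<in>A. (f x, q) \<in> S"
  shows "\<exists>F. bij_betw F (A // R) (Q // S) \<and> (\<forall>x\<in>A. F (R `` {x}) = S `` {f x})"
proof -
  \<comment> \<open>The union over all representatives avoids a choice; on a class all the united
    sets coincide.\<close>
  define F where "F X = (\<Union>x\<in>X. S `` {f x})" for X
  have class_iff: "S `` {f x} = S `` {f y} \<longleftrightarrow> (x, y) \<in> R" if "x \<in> A" "y \<in> A" for x y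
    using that f Q eq_equiv_class_iff[OF S] iff by blast
  have F: "F (R `` {x}) = S `` {f x}" if x: "x \<in> A" for x
  proof -
    have "S `` {f y} = S `` {f x}" if "(x, y) \<in> R" for y
      using that class_iff[OF x] R x unfolding equiv_def by blast
    moreover have "(x, x) \<in> R" using R x by (simp add: equiv_def refl_on_def)
    ultimately show ?thesis unfolding F_def by blast
  qed
  have "inj_on F (A // R)"
    by (rule inj_onI) (auto elim!: quotientE simp: F class_iff equiv_class_eq_iff[OF R] dest: equiv_class_eq[OF R])
  moreover have "F ` (A // R) = Q // S"
  proof
    show "F ` (A // R) \<subseteq> Q // S"
    proof (intro image_subsetI, elim quotientE)
      fix X x assume "x \<in> A" "X = R `` {x}"
      then show "F X \<in> Q // S" using quotientI[OF f, of x] by (simp add: F)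
    qed
    show "Q // S \<subseteq> F ` (A // R)"
    proof
      fix Y assume "Y \<in> Q // S"
      then obtain q where q: "q \<in> Q" "Y = S `` {q}" by (auto elim: quotientE)
      then obtain x where x: "x \<in> A" "(f x, q) \<in> S" using surj by blast
      then have "Y = F (R `` {x})" using q F equiv_class_eq[OF S] by auto
      then show "Y \<in> F ` (A // R)" using x by (auto intro: quotientI)
    qed
  qed
  ultimately show ?thesis using F by (auto simp: bij_betw_def)
qed

section \<open>Koszul signs, cochains and the bracket\<close>

lemma signed_simps [simp]:
  "signed p 0 = 0" "signed 0 v = v" "signed 1 v = - v" "signed p (- v) = - signed p v"
  by (simp_all add: signed_def)

lemma signed_add: "signed p (u + v) = signed p u + signed p v"
  by (simp add: signed_def)

lemma signed_in: "vector_space s \<Longrightarrow> module.subspace s U \<Longrightarrow> v \<in> U \<Longrightarrow> signed p v \<in> U"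
  using module.subspace_neg[of s U v]
  by (auto simp: signed_def module_iff_vector_space)

text \<open>A weak form of multilinearity, just enough to make compositions with the zero cochain
  vanish. It can be checked directly for the cochains \<open>infinitesimal\<close> on
  V[t]/(t^2).\<close>

definition kills_zero :: "'v::zero cochain \<Rightarrow> bool" where
  "kills_zero \<phi> \<longleftrightarrow> (\<forall>us vs. \<phi> (us @ 0 # vs) = 0)"

text \<open>Each entry is split into two elements of \<open>S\<close>. Applied with \<open>S\<close>
  the homogeneous elements, and with \<open>S\<close> the union of M and W.\<close>

lemma multiadditive_eqI:
  fixes \<phi> \<chi> :: "'v::plus list \<Rightarrow> 'u::plus"
  assumes \<phi>: "\<And>us x y vs. \<phi> (us @ (x + y) # vs) = \<phi> (us @ x # vs) + \<phi> (us @ y # vs)"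
    and \<chi>: "\<And>us x y vs. \<chi> (us @ (x + y) # vs) = \<chi> (us @ x # vs) + \<chi> (us @ y # vs)"
    and S: "\<And>v. \<exists>a\<in>S. \<exists>b\<in>S. v = a + b"
    and eq: "\<And>vs. set vs \<subseteq> S \<Longrightarrow> \<phi> vs = \<chi> vs"
  shows "\<phi> vs = \<chi> vs"
proof -
  \<comment> \<open>The prefix \<open>us\<close> collects the entries that have already been
    replaced by elements of \<open>S\<close>.\<close>
  have "\<phi> (us @ vs) = \<chi> (us @ vs)" if "set us \<subseteq> S" for us
    using that
  proof (induction vs arbitrary: us)
    case Nil
    then show ?case by (simp add: eq)
  next
    case (Cons v vs)
    obtain a b where ab: "a \<in> S" "b \<in> S" "v = a + b" using S by blast
    then have "\<phi> (us @ x # vs) = \<chi> (us @ x # vs)" if "x \<in> {a, b}" for x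
      using Cons.IH[of "us @ [x]"] Cons.prems that by auto
    then show ?case using ab by (simp add: \<phi> \<chi>)
  qed
  from this[of "[]"] show ?thesis by simp
qed

context graded_vector_space
begin

lemma decompose: obtains a b where "a \<in> G 0" "b \<in> G 1" "v = a + b"
  using decomposition[of v] by blast

lemma koszul_add:
  assumes "a \<in> G 0" "b \<in> G 1"
  shows "koszul G q (a + b) = a + signed q b"
  unfolding koszul_def
proof (rule the_equality)
  show "\<exists>a'\<in>G 0. \<exists>b'\<in>G 1. a + b = a' + b' \<and> a + signed q b = a' + signed q b'"
    using assms by blast
next
  fix u assume "\<exists>a'\<in>G 0. \<exists>b'\<in>G 1. a + b = a' + b' \<and> u = a' + signed q b'"
  then obtain a' b' where *: "a' \<in> G 0" "b' \<in> G 1" "a + b = a' + b'" "u = a' + signed q b'"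
    by blast
  then have "(a, b) = (a', b')"
    using decomposition[of "a + b"] assms by blast
  then show "u = a + signed q b" using * by simp
qed

lemma zero_in_G: "0 \<in> G p"
  by (rule subspace_0[OF subspace_G])

lemma koszul_homogeneous: "v \<in> G p \<Longrightarrow> koszul G q v = signed (q * p) v"
  using koszul_add[of v 0 q] koszul_add[of 0 v q] zero_in_G by (cases p; cases q) auto

lemma koszul_in_G: "v \<in> G p \<Longrightarrow> koszul G q v \<in> G p"
  using signed_in[OF vector_space_axioms subspace_G] by (simp add: koszul_homogeneous)

lemma koszul_0 [simp]: "koszul G 0 v = v"
  by (rule decompose[of v]) (simp add: koszul_add)

lemma koszul_linear: "Vector_Spaces.linear scale scale (koszul G q)"
  unfolding Vector_Spaces.linear_iff
proof (intro conjI allI vector_space_axioms)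
  fix x y
  obtain a b where x: "a \<in> G 0" "b \<in> G 1" "x = a + b" by (rule decompose)
  obtain c d where y: "c \<in> G 0" "d \<in> G 1" "y = c + d" by (rule decompose)
  have "koszul G q ((a + c) + (b + d)) = (a + c) + signed q (b + d)"
    using x y subspace_add[OF subspace_G] by (intro koszul_add) auto
  then show "koszul G q (x + y) = koszul G q x + koszul G q y"
    using x y by (simp add: koszul_add signed_add algebra_simps)
next
  fix c x
  obtain a b where x: "a \<in> G 0" "b \<in> G 1" "x = a + b" by (rule decompose)
  have "koszul G q (scale c a + scale c b) = scale c a + signed q (scale c b)"
    using x subspace_scale[OF subspace_G] by (intro koszul_add) auto
  then show "koszul G q (scale c x) = scale c (koszul G q x)"
    using x by (simp add: koszul_add signed_def scale_right_distrib)
qed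

lemma koszul_hom: "koszul G q (x + y) = koszul G q x + koszul G q y"
  "koszul G q (scale c x) = scale c (koszul G q x)"
  using koszul_linear unfolding Vector_Spaces.linear_iff by auto

lemma koszul_zero [simp]: "koszul G q 0 = 0"
  using koszul_hom(1)[of q 0 0] by simp

lemma koszul_neg: "koszul G q (- v) = - koszul G q v"
  using koszul_hom(1)[of q "- v" v] by (simp add: eq_neg_iff_add_eq_0)

lemma koszul_koszul: "koszul G q (koszul G q v) = v"
proof (rule decompose[of v])
  fix a b assume "a \<in> G 0" "b \<in> G 1" "v = a + b"
  then show ?thesis using koszul_add[of a "- b" q] subspace_neg[OF subspace_G, of b 1]
    by (cases q) (simp_all add: koszul_add)
qed

section \<open>Multilinearity and parity of cochains\<close>

lemma cochains_iff:
  "\<phi> \<in> cochains scale \<longleftrightarrow>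
     (\<forall>us vs x y. \<phi> (us @ (x + y) # vs) = \<phi> (us @ x # vs) + \<phi> (us @ y # vs)) \<and>
     (\<forall>us vs c x. \<phi> (us @ scale c x # vs) = scale c (\<phi> (us @ x # vs)))"
  unfolding cochains_def Vector_Spaces.linear_iff using vector_space_axioms by auto

lemma cochain_add:
  "\<phi> \<in> cochains scale \<Longrightarrow> \<phi> (us @ (x + y) # vs) = \<phi> (us @ x # vs) + \<phi> (us @ y # vs)"
  by (simp add: cochains_iff)

lemma cochain_zero_entry: "\<phi> \<in> cochains scale \<Longrightarrow> \<phi> (us @ 0 # vs) = 0"
  using cochain_add[of \<phi> us 0 0 vs] by simp

lemma cochain_kills_zero: "\<phi> \<in> cochains scale \<Longrightarrow> kills_zero \<phi>"
  by (simp add: kills_zero_def cochain_zero_entry)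

lemma cochain_neg:
  assumes "\<phi> \<in> cochains scale" shows "\<phi> (us @ (- x) # vs) = - \<phi> (us @ x # vs)"
proof -
  have "\<phi> (us @ (- x) # vs) + \<phi> (us @ x # vs) = 0"
    using cochain_add[OF assms, of us "- x" x vs] cochain_zero_entry[OF assms] by simp
  then show ?thesis by (simp add: eq_neg_iff_add_eq_0)
qed

lemma cochain_diff:
  assumes "\<phi> \<in> cochains scale" shows "\<phi> (us @ (x - y) # vs) = \<phi> (us @ x # vs) - \<phi> (us @ y # vs)"
  using cochain_add[OF assms, of us x "- y" vs] cochain_neg[OF assms] by simp

lemma cochains_add: "\<phi> \<in> cochains scale \<Longrightarrow> \<chi> \<in> cochains scale \<Longrightarrow> \<phi> + \<chi> \<in> cochains scale"
  by (simp add: cochains_iff scale_right_distrib algebra_simps)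

lemma cochains_neg: "\<phi> \<in> cochains scale \<Longrightarrow> - \<phi> \<in> cochains scale"
  by (simp add: cochains_iff)

lemma cochains_diff: "\<phi> \<in> cochains scale \<Longrightarrow> \<chi> \<in> cochains scale \<Longrightarrow> \<phi> - \<chi> \<in> cochains scale"
  using cochains_add[of \<phi> "- \<chi>"] cochains_neg[of \<chi>] by simp

lemma has_parity_add: "has_parity G p \<phi> \<Longrightarrow> has_parity G p \<chi> \<Longrightarrow> has_parity G p (\<phi> + \<chi>)"
  by (simp add: has_parity_def subspace_add[OF subspace_G])

lemma has_parity_neg: "has_parity G p \<phi> \<Longrightarrow> has_parity G p (- \<phi>)"
  by (simp add: has_parity_def subspace_neg[OF subspace_G])

lemma has_parity_diff: "has_parity G p \<phi> \<Longrightarrow> has_parity G p \<chi> \<Longrightarrow> has_parity G p (\<phi> - \<chi>)"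
  using has_parity_add[of p \<phi> "- \<chi>"] has_parity_neg[of p \<chi>] by simp

lemma has_parity_zero: "has_parity G p 0"
  by (simp add: has_parity_def zero_in_G)

text \<open>On homogeneous entries the grading involution multiplies the arguments by (-1)^m, m
  being the sum of their degrees, and the value, of degree p + m, by (-1)^(p+m). The product of the
  two signs is (-1)^p. Both sides are multiadditive, so homogeneous entries suffice.\<close>

lemma koszul_conj:
  assumes \<phi>: "\<phi> \<in> cochains scale" "has_parity G p \<phi>"
  shows "koszul G 1 (\<phi> (map (koszul G 1) vs)) = signed p (\<phi> vs)"
proof (rule multiadditive_eqI[where S = "G 0 \<union> G 1"])
  show "\<exists>a\<in>G 0 \<union> G 1. \<exists>b\<in>G 0 \<union> G 1. v = a + b" for v
    by (rule decompose[of v]) auto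
next
  fix vs assume "set vs \<subseteq> G 0 \<union> G 1"
  then have "\<forall>v\<in>set vs. \<exists>q. v \<in> G q" by blast
  then obtain f where f: "\<forall>v\<in>set vs. v \<in> G (f v)" by metis
  define ps where "ps = map f vs"
  have ps: "list_all2 (\<lambda>q v. v \<in> G q) ps vs"
    using f by (auto simp: ps_def list_all2_conv_all_nth)
  have *: "\<phi> (us @ map (koszul G 1) vs) = signed (sum_list ps) (\<phi> (us @ vs))" for us
    using ps
  proof (induction ps vs arbitrary: us)
    case Nil
    then show ?case by simp
  next
    case (Cons q ps v vs)
    have "\<phi> (us @ map (koszul G 1) (v # vs)) = signed (sum_list ps) (\<phi> (us @ koszul G 1 v # vs))"
      using Cons.IH[of "us @ [koszul G 1 v]"] by simp
    also have "\<phi> (us @ koszul G 1 v # vs) = signed q (\<phi> (us @ v # vs))"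
      using Cons.hyps by (cases q) (simp_all add: koszul_homogeneous cochain_neg \<phi>)
    finally show ?case by (cases q; cases "sum_list ps") (simp_all)
  qed
  have "\<phi> vs \<in> G (p + sum_list ps)" using \<phi>(2) ps by (simp add: has_parity_def)
  then show "koszul G 1 (\<phi> (map (koszul G 1) vs)) = signed p (\<phi> vs)"
    using *[of "[]"]
    by (cases p; cases "sum_list ps") (simp_all add: koszul_neg koszul_homogeneous)
qed (simp_all add: cochain_add \<phi> koszul_hom signed_add)

section \<open>Parity projections and the bracket of homogeneous cochains\<close>

lemma half_double:
  assumes "(2::'k) \<noteq> 0" shows "scale (1/2) (v + v) = v"
  using assms scale_left_distrib[of "1/2" "1/2" v]
  by (simp add: scale_right_distrib flip: add_divide_distrib)

lemma parity_part_homogeneous: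
  assumes "(2::'k) \<noteq> 0" "\<phi> \<in> cochains scale" "has_parity G p \<phi>"
  shows "parity_part scale G q \<phi> = (if q = p then \<phi> else 0)"
proof
  fix vs
  show "parity_part scale G q \<phi> vs = (if q = p then \<phi> else 0) vs"
    by (cases p; cases q) (simp_all add: parity_part_def koszul_conj[OF assms(2,3)] half_double[OF assms(1)])
qed

text \<open>Of the four pairs of parities in the definition a single one survives. The hypotheses
  speak of parity parts and zero entries instead of multilinearity, so that the lemma also covers
  deformations on V[t]/(t^2).\<close>

lemma bracket_homogeneous:
  assumes \<phi>: "kills_zero \<phi>" "\<And>r. parity_part scale G r \<phi> = (if r = p then \<phi> else 0)"
    and \<chi>: "kills_zero \<chi>" "\<And>r. parity_part scale G r \<chi> = (if r = q then \<chi> else 0)"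
  shows "bracket scale G \<phi> \<chi> = (\<lambda>vs. insertion G q \<phi> \<chi> vs - signed (p * q) (insertion G p \<chi> \<phi> vs))"
proof -
  have "insertion G r 0 \<psi> = 0" for r \<psi>
    by (simp add: insertion_def fun_eq_iff)
  moreover have "insertion G r \<phi> 0 = 0" "insertion G r \<chi> 0 = 0" for r
    using \<phi>(1) \<chi>(1) by (simp_all add: insertion_def fun_eq_iff kills_zero_def)
  ultimately show ?thesis
    by (cases p; cases q) (simp_all add: bracket_def \<phi>(2) \<chi>(2))
qed

lemma bracket_cochains:
  assumes "(2::'k) \<noteq> 0" "\<phi> \<in> cochains scale" "has_parity G p \<phi>" "\<chi> \<in> cochains scale" "has_parity G q \<chi>"
  shows "bracket scale G \<phi> \<chi> = (\<lambda>vs. insertion G q \<phi> \<chi> vs - signed (p * q) (insertion G p \<chi> \<phi> vs))"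
  by (rule bracket_homogeneous)
    (simp_all add: assms cochain_kills_zero parity_part_homogeneous[OF assms(1-3)]
      parity_part_homogeneous[OF assms(1,4,5)])

section \<open>Composition: additivity, multilinearity and parity\<close>

lemma insertion_add_left: "insertion G q (\<phi> + \<phi>') \<chi> = insertion G q \<phi> \<chi> + insertion G q \<phi>' \<chi>"
  by (simp add: insertion_def fun_eq_iff sum.distrib)

lemma insertion_add_right:
  "\<phi> \<in> cochains scale \<Longrightarrow> insertion G q \<phi> (\<chi> + \<chi>') = insertion G q \<phi> \<chi> + insertion G q \<phi> \<chi>'"
  by (simp add: insertion_def fun_eq_iff sum.distrib cochain_add)

lemma insertion_cochains:
  assumes \<phi>: "\<phi> \<in> cochains scale" and \<chi>: "\<chi> \<in> cochains scale"
  shows "insertion G q \<phi> \<chi> \<in> cochains scale"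
proof -
  have "Vector_Spaces.linear scale scale (\<lambda>v. insertion G q \<phi> \<chi> (us @ v # vs))" for us vs
  proof -
    let ?f = "\<lambda>l i v. \<phi> (map (koszul G q) (take i (us @ v # vs)) @
        \<chi> (take l (drop i (us @ v # vs))) # drop (i + l) (us @ v # vs))"
    interpret vector_space_pair scale scale ..
    have "Vector_Spaces.linear scale scale (?f l i)" for l i
    proof -
      \<comment> \<open>The entry \<open>v\<close> stands at position \<open>length us\<close>,
        hence in front of, inside or behind the block given to \<chi>. It then passes through the
        Koszul operator and \<phi>, through \<chi> and \<phi>, or through \<phi> alone, all of which
        are linear.\<close>
      consider "length us < i" | "i \<le> length us" "length us < i + l" | "i + l \<le> length us"
        by linarith
      then show ?thesis
      proof cases
        case 1
        then obtain j where "i = Suc (length us + j)" using less_imp_Suc_add by blast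
        then have "?f l i v = \<phi> (map (koszul G q) us @ koszul G q v # (map (koszul G q) (take j vs) @
            \<chi> (take l (drop j vs)) # drop (j + l) vs))" for v
          by simp
        then show ?thesis
          using \<phi> vector_space_axioms by (simp add: Vector_Spaces.linear_iff koszul_hom cochains_iff)
      next
        case 2
        \<comment> \<open>\<open>Suc j\<close> entries of the block come from \<open>v # vs\<close>,
          so the block ends after \<open>j\<close> entries of \<open>vs\<close>.\<close>
        then obtain j where j: "i + l - length us = Suc j" by (metis Suc_diff_Suc)
        then have "l - (length us - i) = Suc j" using 2 by linarith
        then have "?f l i v = \<phi> (map (koszul G q) (take i us) @
            \<chi> (drop i us @ v # take j vs) # drop j vs)" for v
          using 2 j by simp
        then show ?thesis
          using \<phi> \<chi> vector_space_axioms by (simp add: Vector_Spaces.linear_iff cochains_iff)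
      next
        case 3
        then have "?f l i v = \<phi> ((map (koszul G q) (take i us) @ \<chi> (take l (drop i us)) #
            drop (i + l) us) @ v # vs)" for v
          by simp
        then show ?thesis
          using \<phi> vector_space_axioms by (simp only: Vector_Spaces.linear_iff cochains_iff) simp
      qed
    qed
    moreover have "insertion G q \<phi> \<chi> (us @ v # vs) =
        (\<Sum>l\<le>Suc (length us + length vs). \<Sum>i\<le>Suc (length us + length vs) - l. ?f l i v)" for v
      by (simp only: insertion_def length_append list.size add_Suc_right add_0_right)
    ultimately show ?thesis
      by (simp only:) (intro linear_compose_sum ballI)
  qed
  then show ?thesis by (simp add: cochains_def)
qed

lemma insertion_has_parity:
  assumes \<phi>: "has_parity G p \<phi>" and \<chi>: "has_parity G q \<chi>"
  shows "has_parity G (p + q) (insertion G q \<phi> \<chi>)"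
  unfolding has_parity_def insertion_def
proof (intro allI impI subspace_sum[OF subspace_G])
  fix ps vs l i
  assume ps: "list_all2 (\<lambda>q v. v \<in> G q) ps vs"
  have \<chi>_in: "\<chi> (take l (drop i vs)) \<in> G (q + sum_list (take l (drop i ps)))"
    using \<chi> ps unfolding has_parity_def by (blast intro: list_all2_takeI list_all2_dropI)
  \<comment> \<open>The degrees of the arguments of \<phi>: the block counts with the degree of
    \<chi> plus the degrees of its entries, and the Koszul operator preserves degrees.\<close>
  define ps' where "ps' = take i ps @ (q + sum_list (take l (drop i ps))) # drop (i + l) ps"
  have "list_all2 (\<lambda>q v. v \<in> G q) (take i ps) (map (koszul G q) (take i vs))"
    unfolding list_all2_map2 by (rule list_all2_mono[OF list_all2_takeI[OF ps]]) (rule koszul_in_G)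
  then have "list_all2 (\<lambda>q v. v \<in> G q) ps'
      (map (koszul G q) (take i vs) @ \<chi> (take l (drop i vs)) # drop (i + l) vs)"
    unfolding ps'_def by (intro list_all2_appendI list_all2_Cons[THEN iffD2] conjI \<chi>_in list_all2_dropI ps)
  then have "\<phi> (map (koszul G q) (take i vs) @ \<chi> (take l (drop i vs)) # drop (i + l) vs) \<in> G (p + sum_list ps')"
    using \<phi> unfolding has_parity_def by blast
  moreover have "ps = take i ps @ take l (drop i ps) @ drop l (drop i ps)"
    by (simp only: append_take_drop_id)
  then have "sum_list ps = sum_list (take i ps) + (sum_list (take l (drop i ps)) + sum_list (drop (i + l) ps))"
    unfolding drop_drop add.commute[of l i] by (metis sum_list_append)
  then have "p + sum_list ps' = p + q + sum_list ps"
    by (simp only: ps'_def sum_list_append sum_list.Cons ac_simps)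
  ultimately show "\<phi> (map (koszul G q) (take i vs) @ \<chi> (take l (drop i vs)) # drop (i + l) vs) \<in> G (p + q + sum_list ps)"
    by (simp only:)
qed

end

section \<open>Products of graded vector spaces, used for M + W and for V[t]/(t^2)\<close>

lemma graded_vector_space_prod:
  assumes "graded_vector_space s1 G1" "graded_vector_space s2 G2"
  shows "graded_vector_space (module_prod.scale s1 s2) (sum_grading G1 G2)"
proof -
  interpret A: graded_vector_space s1 G1 by fact
  interpret B: graded_vector_space s2 G2 by fact
  interpret P: vector_space_prod s1 s2 by unfold_locales
  show ?thesis
  proof
    show "P.p.subspace (sum_grading G1 G2 p)" for p
      unfolding sum_grading_def by (intro P.subspace_Times A.subspace_G B.subspace_G)
  next
    fix v :: "'b \<times> 'c"
    obtain x y where v: "v = (x, y)" by (cases v)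
    obtain a b where ab: "a \<in> G1 0" "b \<in> G1 1" "x = a + b" by (rule A.decompose)
    obtain c d where cd: "c \<in> G2 0" "d \<in> G2 1" "y = c + d" by (rule B.decompose)
    have "a' = a \<and> b' = b" if "a' \<in> G1 0" "b' \<in> G1 1" "x = a' + b'" for a' b'
      using A.decomposition[of x] ab that by blast
    moreover have "c' = c \<and> d' = d" if "c' \<in> G2 0" "d' \<in> G2 1" "y = c' + d'" for c' d'
      using B.decomposition[of y] cd that by blast
    ultimately show "\<exists>!(a, b). a \<in> sum_grading G1 G2 0 \<and> b \<in> sum_grading G1 G2 1 \<and> v = a + b"
      unfolding v sum_grading_def
    proof (intro ex1I[of _ "((a, c), (b, d))"], goal_cases)
      case 1
      then show ?case using ab cd by simp
    next
      case (2 p)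
      then show ?case by (cases p) fastforce
    qed
  qed
qed

lemma koszul_prod:
  fixes s1 :: "'k::field \<Rightarrow> 'a::ab_group_add \<Rightarrow> 'a" and s2 :: "'k \<Rightarrow> 'b::ab_group_add \<Rightarrow> 'b"
  assumes "graded_vector_space s1 G1" "graded_vector_space s2 G2"
  shows "koszul (sum_grading G1 G2) q (x, y) = (koszul G1 q x, koszul G2 q y)"
proof -
  interpret A: graded_vector_space s1 G1 by fact
  interpret B: graded_vector_space s2 G2 by fact
  interpret P: graded_vector_space "module_prod.scale s1 s2" "sum_grading G1 G2"
    by (rule graded_vector_space_prod[OF assms])
  obtain a b where ab: "a \<in> G1 0" "b \<in> G1 1" "x = a + b" by (rule A.decompose)
  obtain c d where cd: "c \<in> G2 0" "d \<in> G2 1" "y = c + d" by (rule B.decompose)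
  have "koszul (sum_grading G1 G2) q ((a, c) + (b, d)) = (a, c) + signed q (b, d)"
    using ab cd by (intro P.koszul_add) (auto simp: sum_grading_def)
  then show ?thesis
    using ab cd by (simp add: A.koszul_add B.koszul_add signed_def split: if_splits)
qed

text \<open>Support in a single tensor power, separated from multilinearity so that it applies to
  cochains on V[t]/(t^2) as well.\<close>

definition arity :: "nat \<Rightarrow> 'v::zero cochain \<Rightarrow> bool" where
  "arity n \<phi> \<longleftrightarrow> (\<forall>vs. length vs \<noteq> n \<longrightarrow> \<phi> vs = 0)"

lemma arityD: "arity n \<phi> \<Longrightarrow> length vs \<noteq> n \<Longrightarrow> \<phi> vs = 0"
  by (simp add: arity_def)

lemma arity_add: "arity n \<phi> \<Longrightarrow> arity n \<chi> \<Longrightarrow> arity n (\<phi> + \<chi> :: 'v::monoid_add cochain)"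
  by (simp add: arity_def)

text \<open>Blocks of any other length put a zero into \<phi>. The guard matters: for lists shorter
  than \<open>n\<close> the truncated difference would leave a spurious summand
  \<open>i = 0\<close>.\<close>

lemma insertion_arity:
  assumes \<phi>: "kills_zero \<phi>" and \<chi>: "arity n \<chi>"
  shows "insertion G q \<phi> \<chi> vs = (if n \<le> length vs then
    \<Sum>i\<le>length vs - n. \<phi> (map (koszul G q) (take i vs) @ \<chi> (take n (drop i vs)) # drop (i + n) vs) else 0)"
proof -
  have "insertion G q \<phi> \<chi> vs = (\<Sum>l\<le>length vs. if l = n then
    \<Sum>i\<le>length vs - n. \<phi> (map (koszul G q) (take i vs) @ \<chi> (take n (drop i vs)) # drop (i + n) vs) else 0)"
    unfolding insertion_def using \<phi> \<chi> by (intro sum.cong refl) (auto simp: arity_def kills_zero_def)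
  then show ?thesis by simp
qed

text \<open>One argument of \<phi> is the value of \<chi>, so the arity is m + n - 1; the successor
  form avoids truncated subtraction.\<close>

lemma arity_insertion:
  assumes "kills_zero \<phi>" "arity n \<chi>" "arity m \<phi>" "Suc k = m + n"
  shows "arity k (insertion G q \<phi> \<chi>)"
  unfolding arity_def
proof (intro allI impI)
  fix vs :: "'a list" assume "length vs \<noteq> k"
  then have "\<phi> (map (koszul G q) (take i vs) @ \<chi> (take n (drop i vs)) # drop (i + n) vs) = 0"
    if "n \<le> length vs" "i \<le> length vs - n" for i
    using assms(4) that by (intro arityD[OF assms(3)]) auto
  then show "insertion G q \<phi> \<chi> vs = 0"
    by (simp add: insertion_arity[OF assms(1,2)])
qed

text \<open>For \<open>\<phi> = \<chi>\<close>, \<open>q = 1\<close> and an odd \<open>x\<close>,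
  which the Koszul operator sends to \<open>- x\<close>, this is the ordinary associator.\<close>

lemma insertion_2_2:
  assumes "kills_zero \<phi>" "arity 2 \<chi>"
  shows "insertion G q \<phi> \<chi> [x, y, z] = \<phi> [\<chi> [x, y], z] + \<phi> [koszul G q x, \<chi> [y, z]]"
  by (simp add: insertion_arity[OF assms] numeral_2_eq_2)

lemma insertion_2_1:
  assumes "kills_zero \<phi>" "arity 1 \<chi>"
  shows "insertion G q \<phi> \<chi> [x, y] = \<phi> [\<chi> [x], y] + \<phi> [koszul G q x, \<chi> [y]]"
  by (simp add: insertion_arity[OF assms])

lemma insertion_1_2:
  assumes "kills_zero \<phi>" "arity 2 \<chi>"
  shows "insertion G q \<phi> \<chi> [x, y] = \<phi> [\<chi> [x, y]]"
  by (simp add: insertion_arity[OF assms])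

lemma arity_2_eqI:
  assumes "arity 2 \<phi>" "arity 2 \<chi>" "\<And>x y. \<phi> [x, y] = \<chi> [x, y]"
  shows "\<phi> = \<chi>"
proof
  fix vs show "\<phi> vs = \<chi> vs"
    using assms by (cases "length vs = 2") (auto simp: arity_def numeral_2_eq_2 length_Suc_conv)
qed

lemma arity_3_eqI:
  assumes "arity 3 \<phi>" "arity 3 \<chi>" "\<And>x y z. \<phi> [x, y, z] = \<chi> [x, y, z]"
  shows "\<phi> = \<chi>"
proof
  fix vs show "\<phi> vs = \<chi> vs"
    using assms by (cases "length vs = 3") (auto simp: arity_def numeral_3_eq_3 length_Suc_conv)
qed

lemma arity_zero: "arity n 0"
  by (simp add: arity_def)

lemma arity_3_eq_0_iff: "arity 3 \<phi> \<Longrightarrow> (\<forall>x y z. \<phi> [x, y, z] = 0) \<longleftrightarrow> \<phi> = 0"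
  by (auto intro: arity_3_eqI arity_zero)

section \<open>Brackets with odd cochains, and D_d D_d = 0\<close>

context graded_vector_space
begin

lemma double_eq_0_iff: "(2::'k) \<noteq> 0 \<Longrightarrow> v + v = 0 \<longleftrightarrow> (v :: 'v) = 0"
  using half_double[of v] by auto

lemma odd_odd_bracket:
  assumes "(2::'k) \<noteq> 0" "\<phi> \<in> cochains scale" "odd_cochain G \<phi>" "\<chi> \<in> cochains scale" "odd_cochain G \<chi>"
  shows "bracket scale G \<phi> \<chi> = insertion G 1 \<phi> \<chi> + insertion G 1 \<chi> \<phi>"
  by (simp add: bracket_cochains[OF assms] fun_eq_iff)

lemma odd_even_bracket:
  assumes "(2::'k) \<noteq> 0" "\<phi> \<in> cochains scale" "odd_cochain G \<phi>" "\<beta> \<in> cochains scale" "even_cochain G \<beta>"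
  shows "bracket scale G \<phi> \<beta> = insertion G 0 \<phi> \<beta> - insertion G 1 \<beta> \<phi>"
  by (simp add: bracket_cochains[OF assms] fun_eq_iff)

lemma bracket_add_right:
  assumes "(2::'k) \<noteq> 0" "\<phi> \<in> cochains scale" "has_parity G p \<phi>"
    "\<chi> \<in> cochains scale" "has_parity G q \<chi>" "\<chi>' \<in> cochains scale" "has_parity G q \<chi>'"
  shows "bracket scale G \<phi> (\<chi> + \<chi>') = bracket scale G \<phi> \<chi> + bracket scale G \<phi> \<chi>'"
  using assms
  by (simp add: bracket_cochains[of _ p _ q] cochains_add has_parity_add
      insertion_add_left insertion_add_right signed_add fun_eq_iff)

lemma bracket_add_left:
  assumes "(2::'k) \<noteq> 0" "\<phi> \<in> cochains scale" "has_parity G p \<phi>"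
    "\<phi>' \<in> cochains scale" "has_parity G p \<phi>'" "\<chi> \<in> cochains scale" "has_parity G q \<chi>"
  shows "bracket scale G (\<phi> + \<phi>') \<chi> = bracket scale G \<phi> \<chi> + bracket scale G \<phi>' \<chi>"
  using assms
  by (simp add: bracket_cochains[of _ p _ q] cochains_add has_parity_add
      insertion_add_left insertion_add_right signed_add fun_eq_iff)

lemma bracket_zero_right:
  assumes "(2::'k) \<noteq> 0" "\<phi> \<in> cochains scale" "has_parity G p \<phi>"
  shows "bracket scale G \<phi> 0 = 0"
proof -
  have "0 \<in> cochains scale" by (simp add: cochains_iff)
  then show ?thesis
    using bracket_add_right[OF assms, of 0 p 0] by (simp add: has_parity_zero)
qed

lemma bracket_diff_right:
  assumes "(2::'k) \<noteq> 0" "\<phi> \<in> cochains scale" "has_parity G p \<phi>"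
    "\<chi> \<in> cochains scale" "has_parity G q \<chi>" "\<chi>' \<in> cochains scale" "has_parity G q \<chi>'"
  shows "bracket scale G \<phi> (\<chi> - \<chi>') = bracket scale G \<phi> \<chi> - bracket scale G \<phi> \<chi>'"
  using bracket_add_right[OF assms(1-3), of "\<chi> - \<chi>'" q \<chi>'] assms
  by (simp add: cochains_diff has_parity_diff)

lemma cochains_bracket:
  assumes "(2::'k) \<noteq> 0" "\<phi> \<in> cochains scale" "has_parity G p \<phi>" "\<chi> \<in> cochains scale" "has_parity G q \<chi>"
  shows "bracket scale G \<phi> \<chi> \<in> cochains scale" "has_parity G (p + q) (bracket scale G \<phi> \<chi>)"
proof -
  have *: "bracket scale G \<phi> \<chi> = insertion G q \<phi> \<chi> + insertion G p \<chi> \<phi> \<or>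
      bracket scale G \<phi> \<chi> = insertion G q \<phi> \<chi> + - insertion G p \<chi> \<phi>"
    by (cases "p * q") (simp_all add: bracket_cochains[OF assms] fun_eq_iff)
  have "has_parity G (p + q) (insertion G p \<chi> \<phi>)"
    using insertion_has_parity[OF assms(5,3)] by (simp only: add.commute)
  with * show "bracket scale G \<phi> \<chi> \<in> cochains scale" "has_parity G (p + q) (bracket scale G \<phi> \<chi>)"
    using insertion_cochains assms insertion_has_parity[OF assms(3,5)]
    by (metis cochains_add cochains_neg has_parity_add has_parity_neg)+
qed

text \<open>The bracket is the defect of \<beta> from being a derivation of the product
  \<open>d\<close>. No Koszul sign remains because \<beta> is even and \<open>koszul G 0\<close> is
  the identity.\<close>

lemma bracket_2_1:
  assumes char: "(2::'k) \<noteq> 0"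
    and d: "d \<in> cochains scale" "odd_cochain G d" "arity 2 d"
    and \<beta>: "\<beta> \<in> cochains scale" "even_cochain G \<beta>" "arity 1 \<beta>"
  shows "arity 2 (bracket scale G d \<beta>)"
    and "bracket scale G d \<beta> [x, y] = d [\<beta> [x], y] + d [x, \<beta> [y]] - \<beta> [d [x, y]]"
proof -
  note zd = cochain_kills_zero[OF d(1)] and z\<beta> = cochain_kills_zero[OF \<beta>(1)]
  have eq: "bracket scale G d \<beta> = insertion G 0 d \<beta> - insertion G 1 \<beta> d"
    by (rule odd_even_bracket[OF char d(1,2) \<beta>(1,2)])
  have "arity 2 (insertion G 0 d \<beta>)" "arity 2 (insertion G 1 \<beta> d)"
    by (rule arity_insertion[OF zd \<beta>(3) d(3)] arity_insertion[OF z\<beta> d(3) \<beta>(3)], simp)+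
  then show "arity 2 (bracket scale G d \<beta>)" by (simp add: eq arity_def)
  show "bracket scale G d \<beta> [x, y] = d [\<beta> [x], y] + d [x, \<beta> [y]] - \<beta> [d [x, y]]"
    by (simp add: eq insertion_2_1[OF zd \<beta>(3)] insertion_1_2[OF z\<beta> d(3)])
qed

text \<open>Associativity oriented as a rewrite rule: nested products move into the first argument,
  after which the terms of an associator cancel syntactically.\<close>

lemma associative_apply:
  assumes "d \<in> cochains scale" "arity 2 d" "insertion G 1 d d = 0"
  shows "d [koszul G 1 x, d [y, z]] = - d [d [x, y], z]"
  using assms(3) insertion_2_2[OF cochain_kills_zero[OF assms(1)] assms(2), of G 1 x y z]
  by (simp add: eq_neg_iff_add_eq_0 add.commute)

text \<open>\<open>D\<^sub>d \<circ> D\<^sub>d = 0\<close> on \<open>Hom(V, V)\<close>: the four types of terms in \<open>\<beta>\<close> are the associator with \<open>\<beta>\<close>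
  applied to one of its arguments or to its value.\<close>

lemma bracket_bracket_eq_0:
  assumes char: "(2::'k) \<noteq> 0"
    and d: "d \<in> cochains scale" "odd_cochain G d" "arity 2 d" "insertion G 1 d d = 0"
    and \<beta>: "\<beta> \<in> cochains scale" "even_cochain G \<beta>" "arity 1 \<beta>"
  shows "bracket scale G d (bracket scale G d \<beta>) = 0"
proof -
  let ?e = "bracket scale G d \<beta>"
  note zd = cochain_kills_zero[OF d(1)]
  have e: "?e \<in> cochains scale" "odd_cochain G ?e"
    using cochains_bracket[OF char d(1,2) \<beta>(1,2)] by simp_all
  note e2 = bracket_2_1(1)[OF char d(1-3) \<beta>] and e_at = bracket_2_1(2)[OF char d(1-3) \<beta>]
  note assoc = associative_apply[OF d(1,3,4)]
  \<comment> \<open>An even map commutes with the grading involution: this is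
    \<open>koszul_conj\<close> at the involuted argument, the involution being its own
    inverse.\<close>
  have J: "\<beta> [koszul G 1 x] = koszul G 1 (\<beta> [x])" for x
    using koszul_conj[OF \<beta>(1,2), of "[koszul G 1 x]"] by (simp add: koszul_koszul)
  note first = cochain_add[OF d(1), of "[]", simplified] cochain_diff[OF d(1), of "[]", simplified]
    cochain_neg[OF \<beta>(1), of "[]", simplified]
  note second = cochain_add[OF d(1), of "[x]" _ _ "[]" for x, simplified]
    cochain_diff[OF d(1), of "[x]" _ _ "[]" for x, simplified]
  have "insertion G 1 d ?e + insertion G 1 ?e d = 0"
  proof (rule arity_3_eqI)
    show "(insertion G 1 d ?e + insertion G 1 ?e d) [x, y, z] = 0 [x, y, z]" for x y z
      by (simp add: insertion_2_2[OF zd e2] insertion_2_2[OF cochain_kills_zero[OF e(1)] d(3)] e_at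
          first second J assoc)
  next
    show "arity 3 (insertion G 1 d ?e + insertion G 1 ?e d)"
      by (intro arity_add arity_insertion[OF zd e2 d(3)] arity_insertion[OF cochain_kills_zero[OF e(1)] d(3) e2]) simp_all
  qed (rule arity_zero)
  then show ?thesis
    by (simp add: odd_odd_bracket[OF char d(1,2) e])
qed

end

section \<open>First-order deformations\<close>

lemma infinitesimal_2:
  "infinitesimal \<phi> \<phi>\<^sub>1 [x, y] =
     (\<phi> [fst x, fst y], \<phi>\<^sub>1 [fst x, fst y] + (\<phi> [snd x, fst y] + \<phi> [fst x, snd y]))"
  by (simp add: infinitesimal_def numeral_2_eq_2 lessThan_Suc)

lemma infinitesimal_arity: "arity n \<phi> \<Longrightarrow> arity n \<phi>\<^sub>1 \<Longrightarrow> arity n (infinitesimal \<phi> \<phi>\<^sub>1)"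
  by (simp add: arity_def infinitesimal_def zero_prod_def)

lemma infinitesimal_kills_zero:
  fixes \<phi> \<phi>\<^sub>1 :: "'v::ab_group_add cochain"
  assumes "arity 2 \<phi>" "arity 2 \<phi>\<^sub>1" "kills_zero \<phi>" "kills_zero \<phi>\<^sub>1"
  shows "kills_zero (infinitesimal \<phi> \<phi>\<^sub>1)"
  unfolding kills_zero_def
proof (intro allI)
  fix us vs :: "('v \<times> 'v) list"
  have z: "\<phi> [0, x] = 0" "\<phi> [x, 0] = 0" "\<phi>\<^sub>1 [0, x] = 0" "\<phi>\<^sub>1 [x, 0] = 0" for x
    using assms(3,4) unfolding kills_zero_def by (metis append_Nil append_Cons)+
  show "infinitesimal \<phi> \<phi>\<^sub>1 (us @ 0 # vs) = 0"
  proof (cases "length (us @ 0 # vs) = 2")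
    case True
    then have "(\<exists>u. us = [u] \<and> vs = []) \<or> (us = [] \<and> (\<exists>v. vs = [v]))"
      by (cases us) (auto simp: length_Suc_conv)
    then show ?thesis by (auto simp: infinitesimal_2 z zero_prod_def)
  next
    case False
    then show ?thesis by (rule arityD[OF infinitesimal_arity[OF assms(1,2)]])
  qed
qed

context graded_vector_space
begin

lemma dual_graded_vector_space: "graded_vector_space (dual_scale scale) (dual_grading G)"
  by (rule graded_vector_space_prod) (rule graded_vector_space_axioms)+

lemma koszul_dual: "koszul (dual_grading G) q (x, y) = (koszul G q x, koszul G q y)"
  by (rule koszul_prod) (rule graded_vector_space_axioms)+

lemma dual_scale: "dual_scale scale c (x, y) = (scale c x, scale c y)"
proof -
  interpret vector_space_prod scale scale ..
  show ?thesis by (rule scale_prod)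
qed

text \<open>The parameter t is even and Koszul signs act componentwise on \<open>(v, w)\<close>, so
  the projection passes to the coefficients. This supplies the parity hypotheses of
  \<open>bracket_homogeneous\<close> for deformations.\<close>

lemma parity_part_infinitesimal:
  "parity_part (dual_scale scale) (dual_grading G) q (infinitesimal \<phi> \<phi>\<^sub>1) =
     infinitesimal (parity_part scale G q \<phi>) (parity_part scale G q \<phi>\<^sub>1)"
proof
  fix xs :: "('v \<times> 'v) list"
  let ?J = "koszul G 1"
  have *: "map fst (map (koszul (dual_grading G) 1) xs) = map ?J (map fst xs)"
    by (auto simp: koszul_dual[of 1 "fst x" "snd x" for x, simplified])
  have "(map fst (map (koszul (dual_grading G) 1) xs))[i := snd (map (koszul (dual_grading G) 1) xs ! i)] =
      map ?J ((map fst xs)[i := snd (xs ! i)])" if "i < length xs" for i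
    using that koszul_dual[of 1 "fst x" "snd x" for x]
    unfolding * by (simp add: map_update)
  then have inf_eq: "infinitesimal \<phi> \<phi>\<^sub>1 (map (koszul (dual_grading G) 1) xs) =
      (\<phi> (map ?J (map fst xs)), \<phi>\<^sub>1 (map ?J (map fst xs)) +
        (\<Sum>i<length xs. \<phi> (map ?J ((map fst xs)[i := snd (xs ! i)]))))"
    unfolding infinitesimal_def * by simp
  have J_sum: "?J (sum f A) = (\<Sum>a\<in>A. ?J (f a))" for f and A :: "nat set"
    by (induction A rule: infinite_finite_induct) (simp_all add: koszul_hom)
  have signed_sum: "signed q (sum f A) = (\<Sum>a\<in>A. signed q (f a :: 'v))" for f and A :: "nat set"
    by (simp add: signed_def sum_negf)
  have signed_pair: "signed q (x, y) = (signed q x, signed q (y::'v))" for x y :: 'v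
    by (simp add: signed_def)
  show "parity_part (dual_scale scale) (dual_grading G) q (infinitesimal \<phi> \<phi>\<^sub>1) xs =
     infinitesimal (parity_part scale G q \<phi>) (parity_part scale G q \<phi>\<^sub>1) xs"
    unfolding parity_part_def inf_eq
    by (simp add: infinitesimal_def koszul_dual dual_scale koszul_hom signed_add signed_pair J_sum
        signed_sum sum.distrib scale_sum_right scale_right_distrib map_update)
qed

text \<open>The bracket is twice the self-composition, and 2 is invertible. The constant term of the
  self-composition is the associator of \<open>d\<close>. Its t-coefficient consists of the two
  mixed compositions of \<open>d\<close> and \<open>d\<^sub>1\<close> and of associators of
  \<open>d\<close> with one argument replaced by its t-part; all the associators vanish.\<close>

lemma infinitesimal_bracket_eq_0_iff:
  assumes char: "(2::'k) \<noteq> 0"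
    and d: "d \<in> cochains scale" "odd_cochain G d" "arity 2 d" "insertion G 1 d d = 0"
    and d\<^sub>1: "d\<^sub>1 \<in> cochains scale" "odd_cochain G d\<^sub>1" "arity 2 d\<^sub>1"
  shows "bracket (dual_scale scale) (dual_grading G) (infinitesimal d d\<^sub>1) (infinitesimal d d\<^sub>1) = 0 \<longleftrightarrow>
    bracket scale G d d\<^sub>1 = 0"
proof -
  interpret D: graded_vector_space "dual_scale scale" "dual_grading G"
    by (rule dual_graded_vector_space)
  note zd = cochain_kills_zero[OF d(1)] and zd1 = cochain_kills_zero[OF d\<^sub>1(1)]
  let ?D = "infinitesimal d d\<^sub>1" and ?I = "insertion (dual_grading G) 1"
  note zD = infinitesimal_kills_zero[OF d(3) d\<^sub>1(3) zd zd1] and aD = infinitesimal_arity[OF d(3) d\<^sub>1(3)]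
  have "infinitesimal 0 0 = (0 :: ('v \<times> 'v) cochain)"
    by (simp add: infinitesimal_def fun_eq_iff zero_prod_def)
  then have pD: "parity_part (dual_scale scale) (dual_grading G) r ?D = (if r = 1 then ?D else 0)" for r
    by (simp add: parity_part_infinitesimal parity_part_homogeneous[OF char d(1,2)]
        parity_part_homogeneous[OF char d\<^sub>1(1,2)])
  have "bracket (dual_scale scale) (dual_grading G) ?D ?D = 0 \<longleftrightarrow> ?I ?D ?D = 0"
    by (simp add: D.bracket_homogeneous[OF zD pD zD pD] fun_eq_iff D.double_eq_0_iff[OF char])
  also have "\<dots> \<longleftrightarrow> (\<forall>X Y Z. ?I ?D ?D [X, Y, Z] = 0)"
    by (rule arity_3_eq_0_iff[symmetric]) (simp add: arity_insertion[OF zD aD aD])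
  also have "\<dots> \<longleftrightarrow> (\<forall>x y z. (insertion G 1 d d\<^sub>1 + insertion G 1 d\<^sub>1 d) [x, y, z] = 0)"
  proof -
    note assoc = associative_apply[OF d(1,3,4)]
    note first = cochain_add[OF d(1), of "[]", simplified]
      and second = cochain_add[OF d(1), of "[x]" _ _ "[]" for x, simplified]
    have "?I ?D ?D [(x, x'), (y, y'), (z, z')] = (0, (insertion G 1 d d\<^sub>1 + insertion G 1 d\<^sub>1 d) [x, y, z])"
      for x x' y y' z z'
      by (simp add: insertion_2_2[OF zD aD] insertion_2_2[OF zd d\<^sub>1(3)] insertion_2_2[OF zd1 d(3)]
          infinitesimal_2 koszul_dual first second assoc)
    then show ?thesis by (simp add: zero_prod_def)
  qed
  also have "\<dots> \<longleftrightarrow> insertion G 1 d d\<^sub>1 + insertion G 1 d\<^sub>1 d = 0"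
    by (rule arity_3_eq_0_iff)
      (intro arity_add arity_insertion[OF zd d\<^sub>1(3) d(3)] arity_insertion[OF zd1 d(3) d\<^sub>1(3)], simp_all)
  finally show ?thesis by (simp add: odd_odd_bracket[OF char d(1,2) d\<^sub>1(1,2)])
qed

text \<open>As t^2 = 0, the inverse of 1 + t \<beta> is 1 - t \<beta>. In the t-coefficient the two
  inner factors contribute \<open>d [\<beta> [x], y]\<close> and \<open>d [x, \<beta> [y]]\<close>,
  the outer inverse \<open>- \<beta> [d [x, y]]\<close>, together D_d(\<beta>). The terms in the
  t-parts of the arguments agree on both sides.\<close>

lemma infinitesimal_pullback_iff:
  assumes char: "(2::'k) \<noteq> 0"
    and d: "d \<in> cochains scale" "odd_cochain G d" "arity 2 d"
    and d\<^sub>1: "arity 2 d\<^sub>1" and d\<^sub>1': "arity 2 d\<^sub>1'"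
    and \<beta>: "\<beta> \<in> cochains scale" "even_cochain G \<beta>" "arity 1 \<beta>"
  shows "infinitesimal d d\<^sub>1' = pullback (exp_t \<beta>) (infinitesimal d d\<^sub>1) \<longleftrightarrow>
    d\<^sub>1' = d\<^sub>1 + bracket scale G d \<beta>"
proof -
  note e2 = bracket_2_1(1)[OF char d \<beta>] and e_at = bracket_2_1(2)[OF char d \<beta>]
  note first = cochain_add[OF d(1), of "[]", simplified]
    and second = cochain_add[OF d(1), of "[x]" _ _ "[]" for x, simplified]
  have inv: "inv (exp_t \<beta>) (x, y) = (x, y - \<beta> [x])" for x y
    by (rule inv_f_eq) (auto simp: inj_def exp_t_def)
  have exp_t_pair: "exp_t \<beta> (x, y) = (x, y + \<beta> [x])" for x y
    by (simp add: exp_t_def)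
  let ?P = "pullback (exp_t \<beta>) (infinitesimal d d\<^sub>1)"
  \<comment> \<open>Vanishing outside length 2 survives the outer inverse because
    \<open>\<beta> [0] = 0\<close>.\<close>
  have "?P xs = 0" if "length xs \<noteq> 2" for xs
    using that arityD[OF infinitesimal_arity[OF d(3) d\<^sub>1], of "map (exp_t \<beta>) xs"]
      cochain_zero_entry[OF \<beta>(1), of "[]" "[]"]
    by (simp add: pullback_def inv zero_prod_def)
  then have P2: "arity 2 ?P" by (simp add: arity_def)
  have "infinitesimal d d\<^sub>1' = ?P \<longleftrightarrow> (\<forall>X Y. infinitesimal d d\<^sub>1' [X, Y] = ?P [X, Y])"
    using arity_2_eqI[OF infinitesimal_arity[OF d(3) d\<^sub>1'] P2] by auto
  also have "\<dots> \<longleftrightarrow> (\<forall>x y. d\<^sub>1' [x, y] = (d\<^sub>1 + bracket scale G d \<beta>) [x, y])"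
    by (simp add: pullback_def exp_t_pair infinitesimal_2 inv e_at first second algebra_simps)
  also have "\<dots> \<longleftrightarrow> d\<^sub>1' = d\<^sub>1 + bracket scale G d \<beta>"
    using arity_2_eqI[OF d\<^sub>1' arity_add[OF d\<^sub>1 e2]] by auto
  finally show ?thesis .
qed

end

section \<open>Cochains on a direct sum\<close>

text \<open>Compatibility of the grading with V = M + W is recorded as a single property: the Koszul
  operators preserve both summands.\<close>

locale graded_sum = graded_vector_space s G
  for s :: "'k::field \<Rightarrow> 'm::ab_group_add \<times> 'w::ab_group_add \<Rightarrow> 'm \<times> 'w" and G +
  assumes char: "(2::'k) \<noteq> 0"
    and koszul_summand: "v \<in> summand b \<Longrightarrow> koszul G q v \<in> summand b"
begin

abbreviation pure :: "bool list \<Rightarrow> ('m \<times> 'w) list \<Rightarrow> bool" where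
  "pure bs vs \<equiv> list_all2 (\<lambda>b v. v \<in> summand b) bs vs"

lemma summand_zero: "0 \<in> (summand b :: ('m \<times> 'w) set)"
  and summand_add: "u \<in> summand b \<Longrightarrow> v \<in> summand b \<Longrightarrow> u + v \<in> (summand b :: ('m \<times> 'w) set)"
  and summand_neg: "u \<in> summand b \<Longrightarrow> - u \<in> (summand b :: ('m \<times> 'w) set)"
  by (auto simp: summand_def zero_prod_def)

lemma summand_sum: "(\<And>i. i \<in> I \<Longrightarrow> f i \<in> summand b) \<Longrightarrow> sum f I \<in> (summand b :: ('m \<times> 'w) set)"
  by (induction I rule: infinite_finite_induct) (auto simp: summand_zero summand_add)

lemma multiadditive_pure_eqI:
  fixes \<phi> \<chi> :: "('m \<times> 'w) list \<Rightarrow> 'm \<times> 'w"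
  assumes "\<And>us x y vs. \<phi> (us @ (x + y) # vs) = \<phi> (us @ x # vs) + \<phi> (us @ y # vs)"
    and "\<And>us x y vs. \<chi> (us @ (x + y) # vs) = \<chi> (us @ x # vs) + \<chi> (us @ y # vs)"
    and eq: "\<And>bs vs. pure bs vs \<Longrightarrow> \<phi> vs = \<chi> vs"
  shows "\<phi> = \<chi>"
proof
  fix vs
  show "\<phi> vs = \<chi> vs"
  proof (rule multiadditive_eqI[OF assms(1,2), where S = "summand True \<union> summand False"])
    fix v :: "'m \<times> 'w"
    have "v = (fst v, 0) + (0, snd v)" by simp
    then show "\<exists>a\<in>summand True \<union> summand False. \<exists>b\<in>summand True \<union> summand False. v = a + b"
      by (fastforce simp: summand_def)
  next
    fix vs :: "('m \<times> 'w) list" assume "set vs \<subseteq> summand True \<union> summand False"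
    then have "\<forall>v\<in>set vs. \<exists>b. v \<in> summand b" by blast
    then obtain f where "\<forall>v\<in>set vs. v \<in> summand (f v)" by metis
    then have "pure (map f vs) vs" by (auto simp: list_all2_conv_all_nth)
    then show "\<phi> vs = \<chi> vs" by (rule eq)
  qed
qed

lemma cochain_eq_0I:
  assumes "\<phi> \<in> cochains s" "\<And>bs vs. pure bs vs \<Longrightarrow> \<phi> vs = 0"
  shows "\<phi> = 0"
  by (rule multiadditive_pure_eqI) (simp_all add: cochain_add assms)

lemma mixed_homD:
  assumes "\<phi> \<in> mixed_hom s k l U"
  shows "\<phi> \<in> cochains s" "\<phi> vs \<in> U"
    "pure bs vs \<Longrightarrow> (count_list bs True, count_list bs False) \<noteq> (k, l) \<Longrightarrow> \<phi> vs = 0"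
  using assms by (auto simp: mixed_hom_def)

text \<open>The vanishing condition concerns only lists of elements of M or W. On those \<phi>
  agrees with its truncation to length \<open>k + l\<close>; both are multiadditive, hence equal on
  all lists.\<close>

lemma mixed_hom_arity:
  assumes "\<phi> \<in> mixed_hom s k l U" shows "arity (k + l) \<phi>"
proof -
  have "length bs = count_list bs True + count_list bs False" for bs
    by (induction bs) auto
  then have "\<phi> vs = (if length vs = k + l then \<phi> vs else 0)" if "pure bs vs" for bs vs
    using mixed_homD(3)[OF assms that] list_all2_lengthD[OF that] by auto
  then have "\<phi> = (\<lambda>vs. if length vs = k + l then \<phi> vs else 0)"
    using cochain_add[OF mixed_homD(1)[OF assms]] by (intro multiadditive_pure_eqI) auto
  then show ?thesis
    by (metis arity_def)
qed

lemma mixed_hom_add: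
  assumes "\<phi> \<in> mixed_hom s k l (summand b)" "\<chi> \<in> mixed_hom s k l (summand b)"
  shows "\<phi> + \<chi> \<in> mixed_hom s k l (summand b)"
  using assms by (auto simp: mixed_hom_def cochains_add summand_add)

lemma mixed_hom_neg:
  "\<phi> \<in> mixed_hom s k l (summand b) \<Longrightarrow> - \<phi> \<in> mixed_hom s k l (summand b)"
  by (auto simp: mixed_hom_def cochains_neg summand_neg)

lemma mixed_hom_diff:
  "\<phi> \<in> mixed_hom s k l (summand b) \<Longrightarrow> \<chi> \<in> mixed_hom s k l (summand b) \<Longrightarrow>
    \<phi> - \<chi> \<in> mixed_hom s k l (summand b)"
  using mixed_hom_add[of \<phi> k l b "- \<chi>"] mixed_hom_neg[of \<chi> k l b] by simp

lemma mixed_hom_zero: "0 \<in> mixed_hom s k l (summand b)"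
  by (simp add: mixed_hom_def cochains_iff summand_zero)

lemma mixed_hom_eq_0I:
  assumes "\<phi> \<in> mixed_hom s k l U"
    and "\<And>bs vs. pure bs vs \<Longrightarrow> (count_list bs True, count_list bs False) = (k, l) \<Longrightarrow> \<phi> vs = 0"
  shows "\<phi> = 0"
  using assms mixed_homD[OF assms(1)] by (metis cochain_eq_0I)

section \<open>Types of tensors under composition and bracket\<close>

lemma pure_insertion:
  assumes "\<And>vs. \<chi> vs \<in> summand b" "pure bs vs"
  shows "pure (take i bs @ b # drop (i + l) bs)
    (map (koszul G q) (take i vs) @ \<chi> (take l (drop i vs)) # drop (i + l) vs)"
proof -
  have "pure (take i bs) (map (koszul G q) (take i vs))"
    unfolding list_all2_map2
    by (rule list_all2_mono[OF list_all2_takeI[OF assms(2)]]) (rule koszul_summand)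
  then show ?thesis
    by (intro list_all2_appendI list_all2_Cons[THEN iffD2] conjI assms(1) list_all2_dropI assms(2))
qed

text \<open>The composition consumes the arguments of both cochains except for the one slot of
  \<phi> that the value of \<chi> fills. That slot belongs to M if \<open>b\<close> holds and to W
  otherwise, whence the \<open>of_bool\<close> corrections.\<close>

lemma insertion_mixed_hom:
  assumes \<phi>: "\<phi> \<in> mixed_hom s k l (summand c)" and \<chi>: "\<chi> \<in> mixed_hom s k' l' (summand b)"
    and K: "K + of_bool b = k + k'" and L: "L + of_bool (\<not> b) = l + l'"
  shows "insertion G q \<phi> \<chi> \<in> mixed_hom s K L (summand c)"
proof -
  have "insertion G q \<phi> \<chi> vs = 0"
    if vs: "pure bs vs" and bs: "(count_list bs True, count_list bs False) \<noteq> (K, L)" for bs vs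
    unfolding insertion_def
  proof (intro sum.neutral ballI)
    fix n i
    let ?mid = "take n (drop i bs)" and ?out = "take i bs @ b # drop (i + n) bs"
    have "bs = take i bs @ ?mid @ drop n (drop i bs)" by (simp only: append_take_drop_id)
    then have "count_list bs x = count_list (take i bs) x + count_list ?mid x + count_list (drop (i + n) bs) x" for x
      by (metis add.assoc add.commute count_list_append drop_drop)
    \<comment> \<open>If both the block and the outer list had the right type, \<open>K\<close> and
      \<open>L\<close> would force the type (K, L) on \<open>bs\<close>. So one of them is wrong,
      and \<chi> or \<phi> vanishes.\<close>
    then have "(count_list ?mid True, count_list ?mid False) \<noteq> (k', l') \<or>
        (count_list ?out True, count_list ?out False) \<noteq> (k, l)"
      using bs K L by (cases b) auto
    moreover have "\<chi> (take n (drop i vs)) = 0"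
      if "(count_list ?mid True, count_list ?mid False) \<noteq> (k', l')"
      using that vs by (intro mixed_homD(3)[OF \<chi>]) (auto intro: list_all2_takeI list_all2_dropI)
    ultimately consider "\<chi> (take n (drop i vs)) = 0"
      | "(count_list ?out True, count_list ?out False) \<noteq> (k, l)" by blast
    then show "\<phi> (map (koszul G q) (take i vs) @ \<chi> (take n (drop i vs)) # drop (i + n) vs) = 0"
    proof cases
      case 1
      then show ?thesis by (simp only: cochain_zero_entry[OF mixed_homD(1)[OF \<phi>]])
    next
      case 2
      then show ?thesis
        by (rule mixed_homD(3)[OF \<phi> pure_insertion[OF mixed_homD(2)[OF \<chi>] vs]])
    qed
  qed
  moreover have "insertion G q \<phi> \<chi> vs \<in> summand c" for vs
    unfolding insertion_def by (intro summand_sum mixed_homD(2)[OF \<phi>])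
  ultimately show ?thesis
    using insertion_cochains[OF mixed_homD(1)[OF \<phi>] mixed_homD(1)[OF \<chi>]]
    by (auto simp: mixed_hom_def)
qed

text \<open>The values of \<chi> lie in a summand from which \<phi> accepts no argument.\<close>

lemma insertion_eq_0:
  assumes \<phi>: "\<phi> \<in> mixed_hom s k l U" and \<chi>: "\<chi> \<in> mixed_hom s k' l' (summand b)"
    and "(if b then k else l) = 0"
  shows "insertion G q \<phi> \<chi> = 0"
proof (rule cochain_eq_0I)
  fix bs vs assume "pure bs vs"
  moreover have "(count_list (take i bs @ b # drop (i + n) bs) True,
      count_list (take i bs @ b # drop (i + n) bs) False) \<noteq> (k, l)" for i n
    using assms(3) by (auto split: if_splits)
  ultimately show "insertion G q \<phi> \<chi> vs = 0"
    unfolding insertion_def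
    by (intro sum.neutral ballI mixed_homD(3)[OF \<phi> pure_insertion[OF mixed_homD(2)[OF \<chi>]]])
qed (intro insertion_cochains mixed_homD(1)[OF \<phi>] mixed_homD(1)[OF \<chi>])

lemma CM_arity: "\<phi> \<in> CM s k l \<Longrightarrow> arity (k + l) \<phi>"
  unfolding CM_def by (rule mixed_hom_arity)

lemma CW_arity: "\<phi> \<in> CW s n \<Longrightarrow> arity n \<phi>"
  unfolding CW_def using mixed_hom_arity[of \<phi> 0 n] by simp

lemma CM_cochains: "\<phi> \<in> CM s k l \<Longrightarrow> \<phi> \<in> cochains s"
  unfolding CM_def by (rule mixed_homD)

lemma CW_cochains: "\<phi> \<in> CW s n \<Longrightarrow> \<phi> \<in> cochains s"
  unfolding CW_def by (rule mixed_homD)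

lemmas CM_CW_simps = CM_def CW_def

text \<open>Membership in C^{k,l} or C^n does not depend on the sign of the second term, so both
  signs are treated together.\<close>

lemma bracket_eq:
  assumes "\<phi> \<in> cochains s" "has_parity G p \<phi>" "\<chi> \<in> cochains s" "has_parity G q \<chi>"
  obtains "bracket s G \<phi> \<chi> = insertion G q \<phi> \<chi> + insertion G p \<chi> \<phi>"
  | "bracket s G \<phi> \<chi> = insertion G q \<phi> \<chi> - insertion G p \<chi> \<phi>"
  using that by (cases p; cases q) (simp_all add: bracket_cochains[OF char assms] fun_eq_iff)

lemma bracket_CM_CM:
  assumes "\<phi> \<in> CM s k l" "has_parity G p \<phi>" "\<chi> \<in> CM s k' l'" "has_parity G q \<chi>" "Suc K = k + k'" "L = l + l'"
  shows "bracket s G \<phi> \<chi> \<in> CM s K L"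
proof -
  have *: "insertion G q \<phi> \<chi> \<in> CM s K L" "insertion G p \<chi> \<phi> \<in> CM s K L"
    using assms insertion_mixed_hom[of \<phi> k l True \<chi> k' l' True K L q]
      insertion_mixed_hom[of \<chi> k' l' True \<phi> k l True K L p] by (simp_all add: CM_CW_simps)
  show ?thesis
    by (rule bracket_eq[OF CM_cochains[OF assms(1)] assms(2) CM_cochains[OF assms(3)] assms(4)])
      (use * mixed_hom_add mixed_hom_diff in \<open>simp_all add: CM_CW_simps\<close>)
qed

lemma bracket_CW_CW:
  assumes "\<phi> \<in> CW s m" "has_parity G p \<phi>" "\<chi> \<in> CW s n" "has_parity G q \<chi>" "Suc K = m + n"
  shows "bracket s G \<phi> \<chi> \<in> CW s K"
proof -
  have *: "insertion G q \<phi> \<chi> \<in> CW s K" "insertion G p \<chi> \<phi> \<in> CW s K"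
    using assms insertion_mixed_hom[of \<phi> 0 m False \<chi> 0 n False 0 K q]
      insertion_mixed_hom[of \<chi> 0 n False \<phi> 0 m False 0 K p] by (simp_all add: CM_CW_simps)
  show ?thesis
    by (rule bracket_eq[OF CW_cochains[OF assms(1)] assms(2) CW_cochains[OF assms(3)] assms(4)])
      (use * mixed_hom_add mixed_hom_diff in \<open>simp_all add: CM_CW_simps\<close>)
qed

text \<open>Only one composition survives: \<chi> takes arguments from W, while the values of \<phi>
  lie in M.\<close>

lemma bracket_CM_CW:
  assumes "\<phi> \<in> CM s k l" "has_parity G p \<phi>" "\<chi> \<in> CW s n" "has_parity G q \<chi>" "Suc L = l + n"
  shows "bracket s G \<phi> \<chi> \<in> CM s k L" "bracket s G \<chi> \<phi> \<in> CM s k L"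
proof -
  have *: "insertion G q \<phi> \<chi> \<in> CM s k L" "insertion G p \<chi> \<phi> = 0"
    using assms insertion_mixed_hom[of \<phi> k l True \<chi> 0 n False k L q]
      insertion_eq_0[of \<chi> 0 n "summand False" \<phi> k l True p] by (simp_all add: CM_CW_simps)
  show "bracket s G \<phi> \<chi> \<in> CM s k L"
    by (rule bracket_eq[OF CM_cochains[OF assms(1)] assms(2) CW_cochains[OF assms(3)] assms(4)])
      (use * in simp_all)
  show "bracket s G \<chi> \<phi> \<in> CM s k L"
    by (rule bracket_eq[OF CW_cochains[OF assms(3)] assms(4) CM_cochains[OF assms(1)] assms(2)])
      (use * mixed_hom_neg in \<open>simp_all add: CM_CW_simps\<close>)
qed

text \<open>Here \<phi> accepts nothing from W either, so both compositions vanish. This gives D_mu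
  = 0 on C^n and D_delta = 0 on C^{k,0}.\<close>

lemma bracket_CM_CW_eq_0:
  assumes "\<phi> \<in> CM s k 0" "has_parity G p \<phi>" "\<chi> \<in> CW s n" "has_parity G q \<chi>"
  shows "bracket s G \<phi> \<chi> = 0" "bracket s G \<chi> \<phi> = 0"
proof -
  have *: "insertion G q \<phi> \<chi> = 0" "insertion G p \<chi> \<phi> = 0"
    using assms insertion_eq_0[of \<phi> k 0 "summand True" \<chi> 0 n False q]
      insertion_eq_0[of \<chi> 0 n "summand False" \<phi> k 0 True p] by (simp_all add: CM_CW_simps)
  show "bracket s G \<phi> \<chi> = 0"
    by (rule bracket_eq[OF CM_cochains[OF assms(1)] assms(2) CW_cochains[OF assms(3)] assms(4)])
      (use * in simp_all)
  show "bracket s G \<chi> \<phi> = 0"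
    by (rule bracket_eq[OF CW_cochains[OF assms(3)] assms(4) CM_cochains[OF assms(1)] assms(2)])
      (use * in simp_all)
qed

lemma mixed_hom_independent:
  assumes "e \<in> mixed_hom s k l U" "f \<in> mixed_hom s k' l' U'" "g \<in> mixed_hom s k'' l'' U''"
    and "(k, l) \<noteq> (k', l')" "(k, l) \<noteq> (k'', l'')" "e + f + g = 0"
  shows "e = 0"
proof (rule mixed_hom_eq_0I[OF assms(1)])
  fix bs vs assume vs: "pure bs vs" "(count_list bs True, count_list bs False) = (k, l)"
  then have "f vs = 0" "g vs = 0"
    using mixed_homD(3)[OF assms(2) vs(1)] mixed_homD(3)[OF assms(3) vs(1)] assms(4,5) by auto
  moreover have "(e + f + g) vs = 0" using assms(6) by simp
  ultimately show "e vs = 0" by simp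
qed

text \<open>The three summands are supported on tensors of different types; \<open>k\<close> and
  \<open>k'\<close> being nonzero keeps the last two apart from the type (0, n) of the
  first.\<close>

lemma CW_CM_CM_sum_eq_0_iff:
  assumes "e \<in> CW s n" "f \<in> CM s k l" "g \<in> CM s k' l'" "(k, l) \<noteq> (k', l')" "k \<noteq> 0" "k' \<noteq> 0"
  shows "e + f + g = 0 \<longleftrightarrow> e = 0 \<and> f = 0 \<and> g = 0"
proof
  assume *: "e + f + g = 0"
  then have "f + e + g = 0" "g + e + f = 0" by (simp_all add: ac_simps)
  with * show "e = 0 \<and> f = 0 \<and> g = 0"
    using assms mixed_hom_independent[of e 0 n _ f k l _ g k' l']
      mixed_hom_independent[of f k l _ e 0 n _ g k' l'] mixed_hom_independent[of g k' l' _ e 0 n _ f k l]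
    unfolding CM_CW_simps by blast
qed simp

end

section \<open>The extension d, its deformations and their equivalence\<close>

locale extension = graded_sum s G
  for s :: "'k::field \<Rightarrow> 'm::ab_group_add \<times> 'w::ab_group_add \<Rightarrow> 'm \<times> 'w" and G +
  fixes \<delta> \<mu> \<Lambda> :: "('m \<times> 'w) cochain"
  assumes \<delta>: "\<delta> \<in> CW s 2" "odd_cochain G \<delta>"
    and \<mu>: "\<mu> \<in> CM s 2 0" "odd_cochain G \<mu>"
    and \<Lambda>: "\<Lambda> \<in> CM s 1 1" "odd_cochain G \<Lambda>"
    and associative: "bracket s G \<delta> \<delta> = 0" "bracket s G \<mu> \<mu> = 0"
    and "module": "bracket s G \<delta> \<Lambda> + (\<lambda>vs. s (1/2) (bracket s G \<Lambda> \<Lambda> vs)) = 0"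
    and compatible: "bracket s G \<mu> \<Lambda> = 0"
begin

abbreviation br where "br \<equiv> bracket s G"
abbreviation d where "d \<equiv> \<delta> + \<mu> + \<Lambda>"

lemmas cochain = CW_cochains[OF \<delta>(1)] CM_cochains[OF \<mu>(1)] CM_cochains[OF \<Lambda>(1)]

lemma d_cochain: "d \<in> cochains s" and d_odd: "odd_cochain G d" and d_arity: "arity 2 d"
proof -
  show "d \<in> cochains s" "odd_cochain G d"
    using cochain \<delta> \<mu> \<Lambda> by (auto intro: cochains_add has_parity_add)
  have "arity 2 \<delta>" "arity 2 \<mu>" "arity 2 \<Lambda>"
    using CW_arity[OF \<delta>(1)] CM_arity[OF \<mu>(1)] CM_arity[OF \<Lambda>(1)] by (simp_all add: numeral_2_eq_2)
  then show "arity 2 d" by (intro arity_add)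
qed

text \<open>Expanding the self-composition of \<open>d\<close> and grouping its terms, each group is
  one of the structure equations, up to invertible factors 2, except for the mixed terms of \<mu>
  and \<delta>, which vanish by type.\<close>

lemma d_associative: "insertion G 1 d d = 0"
proof -
  let ?i = "insertion G 1"
  have self: "br \<phi> \<phi> = ?i \<phi> \<phi> + ?i \<phi> \<phi>" if "\<phi> \<in> cochains s" "odd_cochain G \<phi>" for \<phi>
    using odd_odd_bracket[OF char that that] .
  have "?i \<delta> \<delta> = 0" "?i \<mu> \<mu> = 0"
    using associative self cochain \<delta> \<mu> by (simp_all add: fun_eq_iff double_eq_0_iff[OF char])
  moreover have "?i \<delta> \<Lambda> + ?i \<Lambda> \<delta> + ?i \<Lambda> \<Lambda> = 0"
    using "module" odd_odd_bracket[OF char cochain(1) \<delta>(2) cochain(3) \<Lambda>(2)] self[OF cochain(3) \<Lambda>(2)]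
    by (simp add: fun_eq_iff half_double[OF char])
  moreover have "?i \<mu> \<Lambda> + ?i \<Lambda> \<mu> = 0"
    using compatible odd_odd_bracket[OF char cochain(2) \<mu>(2) cochain(3) \<Lambda>(2)] by simp
  moreover have "?i \<mu> \<delta> + ?i \<delta> \<mu> = 0"
    using bracket_CM_CW_eq_0(1)[OF \<mu> \<delta>] odd_odd_bracket[OF char cochain(2) \<mu>(2) cochain(1) \<delta>(2)] by simp
  moreover have "?i d d = ?i \<delta> \<delta> + ?i \<mu> \<mu> + (?i \<delta> \<Lambda> + ?i \<Lambda> \<delta> + ?i \<Lambda> \<Lambda>) + (?i \<mu> \<Lambda> + ?i \<Lambda> \<mu>) + (?i \<mu> \<delta> + ?i \<delta> \<mu>)"
    by (simp add: insertion_add_left insertion_add_right cochain cochains_add)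
  ultimately show ?thesis by simp
qed

lemma bracket_d:
  assumes "\<chi> \<in> cochains s" "has_parity G q \<chi>"
  shows "br d \<chi> = br \<delta> \<chi> + br \<mu> \<chi> + br \<Lambda> \<chi>" "br (\<delta> + \<Lambda>) \<chi> = br \<delta> \<chi> + br \<Lambda> \<chi>"
  using assms \<delta> \<mu> \<Lambda>
  by (simp_all add: bracket_add_left[OF char, where p = 1 and q = q] cochain cochains_add has_parity_add)

text \<open>The bracket splits into components in C^3, C^{1,2} and C^{2,1}, which must vanish
  separately.\<close>

lemma bracket_d_deformation_eq_0_iff:
  assumes \<delta>\<^sub>1: "\<delta>\<^sub>1 \<in> CW s 2" "odd_cochain G \<delta>\<^sub>1" and \<Lambda>\<^sub>1: "\<Lambda>\<^sub>1 \<in> CM s 1 1" "odd_cochain G \<Lambda>\<^sub>1"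
  shows "br d (\<delta>\<^sub>1 + \<Lambda>\<^sub>1) = 0 \<longleftrightarrow> br \<delta> \<delta>\<^sub>1 = 0 \<and> br \<mu> \<Lambda>\<^sub>1 = 0 \<and> br (\<delta> + \<Lambda>) \<Lambda>\<^sub>1 = - br \<Lambda> \<delta>\<^sub>1"
proof -
  note c = CW_cochains[OF \<delta>\<^sub>1(1)] CM_cochains[OF \<Lambda>\<^sub>1(1)]
  have add: "br d (\<delta>\<^sub>1 + \<Lambda>\<^sub>1) = br d \<delta>\<^sub>1 + br d \<Lambda>\<^sub>1"
    by (rule bracket_add_right[OF char d_cochain d_odd c(1) \<delta>\<^sub>1(2) c(2) \<Lambda>\<^sub>1(2)])
  have "br d (\<delta>\<^sub>1 + \<Lambda>\<^sub>1) = br \<delta> \<delta>\<^sub>1 + (br \<Lambda> \<delta>\<^sub>1 + br (\<delta> + \<Lambda>) \<Lambda>\<^sub>1) + br \<mu> \<Lambda>\<^sub>1"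
    unfolding add bracket_d[OF c(1) \<delta>\<^sub>1(2)] bracket_d[OF c(2) \<Lambda>\<^sub>1(2)]
    by (simp add: bracket_CM_CW_eq_0[OF \<mu> \<delta>\<^sub>1] ac_simps)
  moreover have "br \<delta> \<delta>\<^sub>1 \<in> CW s 3"
    by (rule bracket_CW_CW[OF \<delta> \<delta>\<^sub>1]) simp
  moreover have "br \<Lambda> \<delta>\<^sub>1 \<in> CM s 1 2" "br \<delta> \<Lambda>\<^sub>1 \<in> CM s 1 2" "br \<Lambda> \<Lambda>\<^sub>1 \<in> CM s 1 2"
    by (rule bracket_CM_CW(1)[OF \<Lambda> \<delta>\<^sub>1] bracket_CM_CW(2)[OF \<Lambda>\<^sub>1 \<delta>] bracket_CM_CM[OF \<Lambda> \<Lambda>\<^sub>1]; simp)+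
  then have "br \<Lambda> \<delta>\<^sub>1 + br (\<delta> + \<Lambda>) \<Lambda>\<^sub>1 \<in> CM s 1 2"
    unfolding bracket_d[OF c(2) \<Lambda>\<^sub>1(2)] CM_def by (intro mixed_hom_add)
  moreover have "br \<mu> \<Lambda>\<^sub>1 \<in> CM s 2 1"
    by (rule bracket_CM_CM[OF \<mu> \<Lambda>\<^sub>1]) simp_all
  ultimately have "br d (\<delta>\<^sub>1 + \<Lambda>\<^sub>1) = 0 \<longleftrightarrow>
      br \<delta> \<delta>\<^sub>1 = 0 \<and> br \<Lambda> \<delta>\<^sub>1 + br (\<delta> + \<Lambda>) \<Lambda>\<^sub>1 = 0 \<and> br \<mu> \<Lambda>\<^sub>1 = 0"
    using CW_CM_CM_sum_eq_0_iff by simp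
  then show ?thesis by (auto simp: eq_neg_iff_add_eq_0 add.commute)
qed

lemma mem_deformations:
  "(\<delta>\<^sub>1, \<Lambda>\<^sub>1) \<in> deformations s G \<delta> \<mu> \<Lambda> \<longleftrightarrow>
     \<delta>\<^sub>1 \<in> CW s 2 \<and> odd_cochain G \<delta>\<^sub>1 \<and> \<Lambda>\<^sub>1 \<in> CM s 1 1 \<and> odd_cochain G \<Lambda>\<^sub>1 \<and> br d (\<delta>\<^sub>1 + \<Lambda>\<^sub>1) = 0"
proof -
  have "bracket (dual_scale s) (dual_grading G) (infinitesimal d (\<delta>\<^sub>1 + \<Lambda>\<^sub>1)) (infinitesimal d (\<delta>\<^sub>1 + \<Lambda>\<^sub>1)) = 0 \<longleftrightarrow>
      br d (\<delta>\<^sub>1 + \<Lambda>\<^sub>1) = 0"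
    if "\<delta>\<^sub>1 \<in> CW s 2" "odd_cochain G \<delta>\<^sub>1" "\<Lambda>\<^sub>1 \<in> CM s 1 1" "odd_cochain G \<Lambda>\<^sub>1"
  proof -
    have "arity 2 \<Lambda>\<^sub>1" using CM_arity[OF that(3)] by (simp add: numeral_2_eq_2)
    then show ?thesis
      by (intro infinitesimal_bracket_eq_0_iff[OF char d_cochain d_odd d_arity d_associative]
        cochains_add has_parity_add arity_add CW_arity[OF that(1)] CW_cochains[OF that(1)]
        CM_cochains[OF that(3)] that(2,4))
  qed
  then show ?thesis by (auto simp: deformations_def Let_def)
qed

text \<open>The condition \<open>br \<mu> \<alpha> = 0\<close> is the C^{2,0}-component of an
  equivalence; it expresses that \<mu> stays fixed.\<close>

definition gauges :: "(('m \<times> 'w) cochain \<times> ('m \<times> 'w) cochain) set" where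
  "gauges = {(\<alpha>, \<gamma>). \<alpha> \<in> CM s 1 0 \<and> even_cochain G \<alpha> \<and> \<gamma> \<in> CW s 1 \<and> even_cochain G \<gamma> \<and> br \<mu> \<alpha> = 0}"

definition trivial_deformations where
  "trivial_deformations = (\<lambda>(\<alpha>, \<gamma>). (br \<delta> \<gamma>, br \<Lambda> (\<alpha> + \<gamma>))) ` gauges"

text \<open>By type \<open>br \<delta> \<alpha>\<close> and \<open>br \<mu> \<gamma>\<close> vanish,
  which leaves one component in each of C^2, C^{1,1} and C^{2,0}.\<close>

lemma bracket_d_gauge:
  assumes \<alpha>: "\<alpha> \<in> CM s 1 0" "even_cochain G \<alpha>" and \<gamma>: "\<gamma> \<in> CW s 1" "even_cochain G \<gamma>"
  shows "br d (\<alpha> + \<gamma>) = br \<delta> \<gamma> + br \<Lambda> (\<alpha> + \<gamma>) + br \<mu> \<alpha>"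
    and "br (\<delta> + \<Lambda>) (\<alpha> + \<gamma>) = br \<delta> \<gamma> + br \<Lambda> (\<alpha> + \<gamma>)"
    and "br \<delta> \<gamma> \<in> CW s 2" "odd_cochain G (br \<delta> \<gamma>)"
    and "br \<Lambda> (\<alpha> + \<gamma>) \<in> CM s 1 1" "odd_cochain G (br \<Lambda> (\<alpha> + \<gamma>))"
    and "br \<mu> \<alpha> \<in> CM s 2 0"
proof -
  note c = CM_cochains[OF \<alpha>(1)] CW_cochains[OF \<gamma>(1)]
  note sum = cochains_add[OF c] has_parity_add[OF \<alpha>(2) \<gamma>(2)]
  have add: "br \<phi> (\<alpha> + \<gamma>) = br \<phi> \<alpha> + br \<phi> \<gamma>" if "\<phi> \<in> cochains s" "odd_cochain G \<phi>" for \<phi>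
    by (rule bracket_add_right[OF char that c(1) \<alpha>(2) c(2) \<gamma>(2)])
  show "br d (\<alpha> + \<gamma>) = br \<delta> \<gamma> + br \<Lambda> (\<alpha> + \<gamma>) + br \<mu> \<alpha>"
    "br (\<delta> + \<Lambda>) (\<alpha> + \<gamma>) = br \<delta> \<gamma> + br \<Lambda> (\<alpha> + \<gamma>)"
    unfolding bracket_d[OF sum] add[OF cochain(1) \<delta>(2)] add[OF cochain(2) \<mu>(2)]
    by (simp_all add: bracket_CM_CW_eq_0[OF \<mu> \<gamma>] bracket_CM_CW_eq_0[OF \<alpha> \<delta>] ac_simps)
  show "br \<delta> \<gamma> \<in> CW s 2" by (rule bracket_CW_CW[OF \<delta> \<gamma>]) simp
  show "odd_cochain G (br \<delta> \<gamma>)" "odd_cochain G (br \<Lambda> (\<alpha> + \<gamma>))"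
    using cochains_bracket(2)[OF char cochain(1) \<delta>(2) c(2) \<gamma>(2)]
      cochains_bracket(2)[OF char cochain(3) \<Lambda>(2) sum] by simp_all
  have "br \<Lambda> \<alpha> \<in> CM s 1 1" "br \<Lambda> \<gamma> \<in> CM s 1 1"
    by (rule bracket_CM_CM[OF \<Lambda> \<alpha>] bracket_CM_CW(1)[OF \<Lambda> \<gamma>]; simp)+
  then show "br \<Lambda> (\<alpha> + \<gamma>) \<in> CM s 1 1"
    unfolding add[OF cochain(3) \<Lambda>(2)] CM_def by (rule mixed_hom_add)
  show "br \<mu> \<alpha> \<in> CM s 2 0" by (rule bracket_CM_CM[OF \<mu> \<alpha>]) simp_all
qed

text \<open>For a gauge the C^{2,0}-component is zero, so the sum of the pair is D_d(\<alpha> +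
  \<gamma>), a cocycle by D_d D_d = 0.\<close>

lemma trivial_deformations_subset: "trivial_deformations \<subseteq> deformations s G \<delta> \<mu> \<Lambda>"
proof
  fix x assume "x \<in> trivial_deformations"
  then obtain \<alpha> \<gamma> where x: "x = (br \<delta> \<gamma>, br \<Lambda> (\<alpha> + \<gamma>))" "br \<mu> \<alpha> = 0"
    and \<alpha>: "\<alpha> \<in> CM s 1 0" "even_cochain G \<alpha>" and \<gamma>: "\<gamma> \<in> CW s 1" "even_cochain G \<gamma>"
    by (auto simp: trivial_deformations_def gauges_def)
  have "arity 1 (\<alpha> + \<gamma>)"
    using arity_add[OF CM_arity[OF \<alpha>(1)]] CW_arity[OF \<gamma>(1)] by simp
  then have "br d (br d (\<alpha> + \<gamma>)) = 0"
    by (intro bracket_bracket_eq_0[OF char d_cochain d_odd d_arity d_associative] cochains_add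
        has_parity_add CM_cochains[OF \<alpha>(1)] CW_cochains[OF \<gamma>(1)] \<alpha>(2) \<gamma>(2))
  then show "x \<in> deformations s G \<delta> \<mu> \<Lambda>"
    unfolding x(1) mem_deformations using bracket_d_gauge[OF \<alpha> \<gamma>] x(2) by simp
qed

lemma gauges_diff:
  assumes "(\<alpha>, \<gamma>) \<in> gauges" "(\<alpha>', \<gamma>') \<in> gauges"
  shows "(\<alpha> - \<alpha>', \<gamma> - \<gamma>') \<in> gauges" "br \<delta> (\<gamma> - \<gamma>') = br \<delta> \<gamma> - br \<delta> \<gamma>'"
    "br \<Lambda> (\<alpha> - \<alpha>' + (\<gamma> - \<gamma>')) = br \<Lambda> (\<alpha> + \<gamma>) - br \<Lambda> (\<alpha>' + \<gamma>')"
proof -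
  have c: "\<alpha> \<in> cochains s" "\<alpha>' \<in> cochains s" "\<gamma> \<in> cochains s" "\<gamma>' \<in> cochains s"
    "even_cochain G \<alpha>" "even_cochain G \<alpha>'" "even_cochain G \<gamma>" "even_cochain G \<gamma>'"
    using assms by (auto simp: gauges_def intro: CM_cochains CW_cochains)
  show "br \<delta> (\<gamma> - \<gamma>') = br \<delta> \<gamma> - br \<delta> \<gamma>'"
    by (rule bracket_diff_right[OF char cochain(1) \<delta>(2)]) (rule c)+
  have "br \<Lambda> (\<alpha> + \<gamma> - (\<alpha>' + \<gamma>')) = br \<Lambda> (\<alpha> + \<gamma>) - br \<Lambda> (\<alpha>' + \<gamma>')"
    using c by (intro bracket_diff_right[OF char cochain(3) \<Lambda>(2)] cochains_add has_parity_add)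
  then show "br \<Lambda> (\<alpha> - \<alpha>' + (\<gamma> - \<gamma>')) = br \<Lambda> (\<alpha> + \<gamma>) - br \<Lambda> (\<alpha>' + \<gamma>')"
    by (simp add: algebra_simps)
  have "br \<mu> (\<alpha> - \<alpha>') = br \<mu> \<alpha> - br \<mu> \<alpha>'"
    by (rule bracket_diff_right[OF char cochain(2) \<mu>(2)]) (rule c)+
  then show "(\<alpha> - \<alpha>', \<gamma> - \<gamma>') \<in> gauges"
    using assms c by (simp add: gauges_def CM_def CW_def mixed_hom_diff has_parity_diff)
qed

lemma gauges_zero: "(0, 0) \<in> gauges"
  by (simp add: gauges_def CM_def CW_def mixed_hom_zero has_parity_zero
      bracket_zero_right[OF char cochain(2) \<mu>(2)])

lemma trivial_deformations_diff:
  assumes "x \<in> trivial_deformations" "y \<in> trivial_deformations"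
  shows "x - y \<in> trivial_deformations"
proof -
  obtain \<alpha> \<gamma> \<alpha>' \<gamma>' where g: "(\<alpha>, \<gamma>) \<in> gauges" "(\<alpha>', \<gamma>') \<in> gauges"
    and "x = (br \<delta> \<gamma>, br \<Lambda> (\<alpha> + \<gamma>))" "y = (br \<delta> \<gamma>', br \<Lambda> (\<alpha>' + \<gamma>'))"
    using assms by (auto simp: trivial_deformations_def)
  then have "x - y = (\<lambda>(\<alpha>, \<gamma>). (br \<delta> \<gamma>, br \<Lambda> (\<alpha> + \<gamma>))) (\<alpha> - \<alpha>', \<gamma> - \<gamma>')"
    using gauges_diff[OF g] by simp
  then show ?thesis
    unfolding trivial_deformations_def using gauges_diff(1)[OF g] by (rule image_eqI)
qed

lemma trivial_deformations_zero: "0 \<in> trivial_deformations"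
  using trivial_deformations_diff[of x x for x] gauges_zero
  by (fastforce simp: trivial_deformations_def)

lemma deformations_diff:
  assumes "x \<in> deformations s G \<delta> \<mu> \<Lambda>" "y \<in> deformations s G \<delta> \<mu> \<Lambda>"
  shows "x - y \<in> deformations s G \<delta> \<mu> \<Lambda>"
proof -
  obtain \<delta>\<^sub>1 \<Lambda>\<^sub>1 \<delta>\<^sub>1' \<Lambda>\<^sub>1' where x: "x = (\<delta>\<^sub>1, \<Lambda>\<^sub>1)" "y = (\<delta>\<^sub>1', \<Lambda>\<^sub>1')" by (cases x; cases y)
  have "br d (\<delta>\<^sub>1 + \<Lambda>\<^sub>1 - (\<delta>\<^sub>1' + \<Lambda>\<^sub>1')) = br d (\<delta>\<^sub>1 + \<Lambda>\<^sub>1) - br d (\<delta>\<^sub>1' + \<Lambda>\<^sub>1')"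
    using assms unfolding x mem_deformations
    by (intro bracket_diff_right[OF char d_cochain d_odd] cochains_add has_parity_add)
      (auto intro: CM_cochains CW_cochains)
  then have "br d (\<delta>\<^sub>1 - \<delta>\<^sub>1' + (\<Lambda>\<^sub>1 - \<Lambda>\<^sub>1')) = 0"
    using assms unfolding x mem_deformations add_diff_add[symmetric] by simp
  then show ?thesis
    using assms unfolding x mem_deformations diff_Pair
    by (simp add: CM_def CW_def mixed_hom_diff has_parity_diff)
qed

text \<open>The pullback equation says that the two deformations differ by D_d(\<alpha> + \<gamma>).
  Its components in C^2 and C^{1,1} are the two coordinates of the difference, and the one in
  C^{2,0} is the gauge condition.\<close>

lemma inf_equivalence_eq:
  "inf_equivalence s G \<delta> \<mu> \<Lambda> = difference_relation (deformations s G \<delta> \<mu> \<Lambda>) trivial_deformations"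
proof -
  have "infinitesimal d (\<delta>\<^sub>1' + \<Lambda>\<^sub>1') = pullback (exp_t (\<alpha> + \<gamma>)) (infinitesimal d (\<delta>\<^sub>1 + \<Lambda>\<^sub>1)) \<longleftrightarrow>
      br \<mu> \<alpha> = 0 \<and> \<delta>\<^sub>1' - \<delta>\<^sub>1 = br \<delta> \<gamma> \<and> \<Lambda>\<^sub>1' - \<Lambda>\<^sub>1 = br \<Lambda> (\<alpha> + \<gamma>)"
    if x: "(\<delta>\<^sub>1, \<Lambda>\<^sub>1) \<in> deformations s G \<delta> \<mu> \<Lambda>" "(\<delta>\<^sub>1', \<Lambda>\<^sub>1') \<in> deformations s G \<delta> \<mu> \<Lambda>"
      and \<alpha>: "\<alpha> \<in> CM s 1 0" "even_cochain G \<alpha>" and \<gamma>: "\<gamma> \<in> CW s 1" "even_cochain G \<gamma>"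
    for \<delta>\<^sub>1 \<Lambda>\<^sub>1 \<delta>\<^sub>1' \<Lambda>\<^sub>1' \<alpha> \<gamma>
  proof -
    note g = bracket_d_gauge[OF \<alpha> \<gamma>]
    have ar: "arity 2 (\<delta>\<^sub>1 + \<Lambda>\<^sub>1)" if "(\<delta>\<^sub>1, \<Lambda>\<^sub>1) \<in> deformations s G \<delta> \<mu> \<Lambda>" for \<delta>\<^sub>1 \<Lambda>\<^sub>1
      using that CW_arity[of \<delta>\<^sub>1 2] CM_arity[of \<Lambda>\<^sub>1 1 1]
      by (intro arity_add) (simp_all add: mem_deformations numeral_2_eq_2)
    have "arity 1 (\<alpha> + \<gamma>)"
      using arity_add[OF CM_arity[OF \<alpha>(1)]] CW_arity[OF \<gamma>(1)] by simp
    then have "infinitesimal d (\<delta>\<^sub>1' + \<Lambda>\<^sub>1') = pullback (exp_t (\<alpha> + \<gamma>)) (infinitesimal d (\<delta>\<^sub>1 + \<Lambda>\<^sub>1)) \<longleftrightarrow>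
        \<delta>\<^sub>1' + \<Lambda>\<^sub>1' = \<delta>\<^sub>1 + \<Lambda>\<^sub>1 + br d (\<alpha> + \<gamma>)"
      by (intro infinitesimal_pullback_iff[OF char d_cochain d_odd d_arity] ar x cochains_add
        has_parity_add CM_cochains[OF \<alpha>(1)] CW_cochains[OF \<gamma>(1)] \<alpha>(2) \<gamma>(2))
    also have "\<dots> \<longleftrightarrow> (br \<delta> \<gamma> - (\<delta>\<^sub>1' - \<delta>\<^sub>1)) + (br \<Lambda> (\<alpha> + \<gamma>) - (\<Lambda>\<^sub>1' - \<Lambda>\<^sub>1)) + br \<mu> \<alpha> = 0"
      unfolding g(1) by (auto simp: algebra_simps)
    also have "\<dots> \<longleftrightarrow> br \<delta> \<gamma> - (\<delta>\<^sub>1' - \<delta>\<^sub>1) = 0 \<and> br \<Lambda> (\<alpha> + \<gamma>) - (\<Lambda>\<^sub>1' - \<Lambda>\<^sub>1) = 0 \<and> br \<mu> \<alpha> = 0"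
    proof (rule CW_CM_CM_sum_eq_0_iff)
      show "br \<delta> \<gamma> - (\<delta>\<^sub>1' - \<delta>\<^sub>1) \<in> CW s 2" "br \<Lambda> (\<alpha> + \<gamma>) - (\<Lambda>\<^sub>1' - \<Lambda>\<^sub>1) \<in> CM s 1 1"
        using g(3,5) x unfolding mem_deformations CM_CW_simps by (blast intro: mixed_hom_diff)+
    qed (rule g(7), simp_all)
    finally show ?thesis by auto
  qed
  note * = this
  have "((\<delta>\<^sub>1, \<Lambda>\<^sub>1), (\<delta>\<^sub>1', \<Lambda>\<^sub>1')) \<in> inf_equivalence s G \<delta> \<mu> \<Lambda> \<longleftrightarrow>
      ((\<delta>\<^sub>1, \<Lambda>\<^sub>1), (\<delta>\<^sub>1', \<Lambda>\<^sub>1')) \<in> difference_relation (deformations s G \<delta> \<mu> \<Lambda>) trivial_deformations"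
    for \<delta>\<^sub>1 \<Lambda>\<^sub>1 \<delta>\<^sub>1' \<Lambda>\<^sub>1'
    using *[of \<delta>\<^sub>1 \<Lambda>\<^sub>1 \<delta>\<^sub>1' \<Lambda>\<^sub>1']
    unfolding inf_equivalence_def difference_relation_def trivial_deformations_def gauges_def image_def
    by (simp add: split_paired_Ex Bex_def) blast
  then show ?thesis by auto
qed

section \<open>Cohomology classes in terms of deformations\<close>

lemma mem_deformations_iff:
  "(\<delta>\<^sub>1, \<Lambda>\<^sub>1) \<in> deformations s G \<delta> \<mu> \<Lambda> \<longleftrightarrow> \<delta>\<^sub>1 \<in> delta_cocycles s G \<delta> \<and>
     \<Lambda>\<^sub>1 \<in> CM s 1 1 \<and> odd_cochain G \<Lambda>\<^sub>1 \<and> br \<mu> \<Lambda>\<^sub>1 = 0 \<and> br (\<delta> + \<Lambda>) \<Lambda>\<^sub>1 = - br \<Lambda> \<delta>\<^sub>1"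
  unfolding mem_deformations delta_cocycles_def
  using bracket_d_deformation_eq_0_iff[of \<delta>\<^sub>1 \<Lambda>\<^sub>1] by blast

text \<open>All barred objects of the classification live in C^{1,l}, so this turns every equation
  between classes into one between cochains.\<close>

lemma mu_class_singleton: "k \<le> 1 \<Longrightarrow> mu_class s G \<mu> k l \<phi> = {\<phi>}"
  by (simp add: mu_class_def mu_coboundaries_def)

lemma obstruction_vanishes_iff:
  assumes "\<delta>\<^sub>1 \<in> delta_cocycles s G \<delta>"
  shows "obstruction_vanishes s G \<delta> \<mu> \<Lambda> \<delta>\<^sub>1 \<longleftrightarrow> (\<exists>\<Lambda>\<^sub>1. (\<delta>\<^sub>1, \<Lambda>\<^sub>1) \<in> deformations s G \<delta> \<mu> \<Lambda>)"
  using assms unfolding obstruction_vanishes_def mem_deformations_iff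
  by (auto simp: mu_class_singleton)

lemma tau_cocycles_iff: "\<tau> \<in> tau_cocycles s G \<delta> \<mu> \<Lambda> \<longleftrightarrow> (0, \<tau>) \<in> deformations s G \<delta> \<mu> \<Lambda>"
proof -
  have "0 \<in> delta_cocycles s G \<delta>"
    by (simp add: delta_cocycles_def CW_def mixed_hom_zero has_parity_zero
        bracket_zero_right[OF char cochain(1) \<delta>(2)])
  then show ?thesis
    unfolding tau_cocycles_def mem_deformations_iff
    by (simp add: mu_class_singleton bracket_zero_right[OF char cochain(3) \<Lambda>(2)])
qed

lemma tau_bar_cocycles_eq:
  "tau_bar_cocycles s G \<delta> \<mu> \<Lambda> = (\<lambda>\<tau>. {\<tau>}) ` {\<tau>. (0, \<tau>) \<in> deformations s G \<delta> \<mu> \<Lambda>}"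
  by (auto simp: tau_bar_cocycles_def mu_class_singleton tau_cocycles_iff image_def)

text \<open>A trivial deformation has first component zero iff D_delta(\<gamma>) = 0, and then
  D_{delta+lambda}(\<alpha> + \<gamma>) is its second component.\<close>

lemma tau_bar_cohomologous_iff:
  "({\<tau>}, {\<tau>'}) \<in> tau_bar_cohomologous s G \<delta> \<mu> \<Lambda> \<longleftrightarrow>
     ((0, \<tau>), (0, \<tau>')) \<in> inf_equivalence s G \<delta> \<mu> \<Lambda>"
proof -
  have "(0, \<tau>' - \<tau>) \<in> trivial_deformations \<longleftrightarrow>
      (\<exists>\<alpha>\<in>CM s 1 0. \<exists>\<gamma>\<in>CW s 1. even_cochain G \<alpha> \<and> even_cochain G \<gamma> \<and> br \<mu> \<alpha> = 0 \<and> br \<delta> \<gamma> = 0 \<and>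
        \<tau>' - \<tau> = br (\<delta> + \<Lambda>) (\<alpha> + \<gamma>))"
    unfolding trivial_deformations_def gauges_def
    using bracket_d_gauge(2) by (fastforce simp: image_def)
  then show ?thesis
    unfolding tau_bar_cohomologous_def inf_equivalence_eq difference_relation_def
    by (auto simp: mu_class_singleton tau_cocycles_iff)
qed

text \<open>Every even \<gamma> is completed to a gauge by \<open>\<alpha> = 0\<close>, so the first
  components of trivial deformations are all the D_delta-coboundaries.\<close>

lemma delta_cohomologous_eq:
  "delta_cohomologous s G \<delta> = difference_relation (delta_cocycles s G \<delta>) (fst ` trivial_deformations)"
proof -
  have "0 \<in> CM s 1 0" "even_cochain G 0" "br \<mu> 0 = 0"
    using gauges_zero by (auto simp: gauges_def)
  then have "fst ` trivial_deformations = br \<delta> ` {\<gamma> \<in> CW s 1. even_cochain G \<gamma>}"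
    unfolding trivial_deformations_def gauges_def by (force simp: image_def)
  then show ?thesis
    by (auto simp: delta_cohomologous_def difference_relation_def image_def algebra_simps)
qed

section \<open>Equivalence relations and the classification\<close>

lemma equiv_inf_equivalence: "equiv (deformations s G \<delta> \<mu> \<Lambda>) (inf_equivalence s G \<delta> \<mu> \<Lambda>)"
  unfolding inf_equivalence_eq
  by (intro equiv_difference_relation trivial_deformations_zero trivial_deformations_diff)

lemma equiv_delta_cohomologous: "equiv (delta_cocycles s G \<delta>) (delta_cohomologous s G \<delta>)"
  unfolding delta_cohomologous_eq
proof (rule equiv_difference_relation)
  show "0 \<in> fst ` trivial_deformations"
    using trivial_deformations_zero by (force simp: zero_prod_def)
  show "x - y \<in> fst ` trivial_deformations"
    if "x \<in> fst ` trivial_deformations" "y \<in> fst ` trivial_deformations" for x y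
    using that trivial_deformations_diff by (force simp: image_iff)
qed

text \<open>The relation is inherited from infinitesimal equivalence along the map from
  \<open>{\<tau>}\<close> to \<open>(0, \<tau>)\<close>.\<close>

lemma equiv_tau_bar_cohomologous:
  "equiv (tau_bar_cocycles s G \<delta> \<mu> \<Lambda>) (tau_bar_cohomologous s G \<delta> \<mu> \<Lambda>)"
proof -
  have sub: "tau_bar_cohomologous s G \<delta> \<mu> \<Lambda> \<subseteq> tau_bar_cocycles s G \<delta> \<mu> \<Lambda> \<times> tau_bar_cocycles s G \<delta> \<mu> \<Lambda>"
    by (auto simp: tau_bar_cohomologous_def tau_bar_cocycles_def)
  have iff: "(X, Y) \<in> tau_bar_cohomologous s G \<delta> \<mu> \<Lambda> \<longleftrightarrow>
      (\<exists>\<tau> \<tau>'. X = {\<tau>} \<and> Y = {\<tau>'} \<and> ((0, \<tau>), (0, \<tau>')) \<in> inf_equivalence s G \<delta> \<mu> \<Lambda>)" for X Y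
    using sub tau_bar_cohomologous_iff unfolding tau_bar_cocycles_eq by blast
  note E = equiv_inf_equivalence[unfolded equiv_def]
  show ?thesis
  proof (rule equivI[OF sub])
    show "refl_on (tau_bar_cocycles s G \<delta> \<mu> \<Lambda>) (tau_bar_cohomologous s G \<delta> \<mu> \<Lambda>)"
      using E by (auto simp: refl_on_def tau_bar_cocycles_eq tau_bar_cohomologous_iff)
    show "sym (tau_bar_cohomologous s G \<delta> \<mu> \<Lambda>)"
      using E unfolding sym_def iff by blast
    show "trans (tau_bar_cohomologous s G \<delta> \<mu> \<Lambda>)"
      using E unfolding trans_def iff by blast
  qed
qed

text \<open>A trivial deformation with first component
  \<open>\<delta>\<^sub>1' - \<delta>\<^sub>1\<close> is itself a deformation, so adding it moves
  any deformation over one representative to the other.\<close>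

lemma deformation_translate:
  assumes "(\<delta>\<^sub>1, \<Lambda>\<^sub>1) \<in> deformations s G \<delta> \<mu> \<Lambda>" "(\<delta>\<^sub>1, \<delta>\<^sub>1') \<in> delta_cohomologous s G \<delta>"
  obtains b where "(\<delta>\<^sub>1' - \<delta>\<^sub>1, b) \<in> trivial_deformations" "(\<delta>\<^sub>1', \<Lambda>\<^sub>1 + b) \<in> deformations s G \<delta> \<mu> \<Lambda>"
proof -
  obtain b where b: "(\<delta>\<^sub>1' - \<delta>\<^sub>1, b) \<in> trivial_deformations"
    using assms(2) by (force simp: delta_cohomologous_eq difference_relation_def)
  \<comment> \<open>The sum is formed as a double difference, both sets being known to be closed
    under differences.\<close>
  have "0 - (\<delta>\<^sub>1' - \<delta>\<^sub>1, b) \<in> trivial_deformations"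
    by (rule trivial_deformations_diff[OF trivial_deformations_zero b])
  then have "(\<delta>\<^sub>1, \<Lambda>\<^sub>1) - (0 - (\<delta>\<^sub>1' - \<delta>\<^sub>1, b)) \<in> deformations s G \<delta> \<mu> \<Lambda>"
    by (rule deformations_diff[OF assms(1) subsetD[OF trivial_deformations_subset]])
  then show ?thesis using b that[of b] by (simp add: zero_prod_def)
qed

lemma obstruction_vanishes_cong:
  assumes "(\<delta>\<^sub>1, \<delta>\<^sub>1') \<in> delta_cohomologous s G \<delta>"
  shows "obstruction_vanishes s G \<delta> \<mu> \<Lambda> \<delta>\<^sub>1 \<longleftrightarrow> obstruction_vanishes s G \<delta> \<mu> \<Lambda> \<delta>\<^sub>1'"
proof -
  have "(\<delta>\<^sub>1', \<delta>\<^sub>1) \<in> delta_cohomologous s G \<delta>"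
    using equiv_delta_cohomologous assms by (auto simp: equiv_def dest: symD)
  moreover have "\<delta>\<^sub>1 \<in> delta_cocycles s G \<delta>" "\<delta>\<^sub>1' \<in> delta_cocycles s G \<delta>"
    using assms by (auto simp: delta_cohomologous_def)
  ultimately show ?thesis
    using assms by (auto simp: obstruction_vanishes_iff elim: deformation_translate)
qed

lemma inf_equivalence_delta_cohomologous:
  assumes "((\<delta>\<^sub>1, \<Lambda>\<^sub>1), (\<delta>\<^sub>1', \<Lambda>\<^sub>1')) \<in> inf_equivalence s G \<delta> \<mu> \<Lambda>"
  shows "(\<delta>\<^sub>1, \<delta>\<^sub>1') \<in> delta_cohomologous s G \<delta>"
  using assms unfolding inf_equivalence_eq delta_cohomologous_eq
  by (force simp: difference_relation_def mem_deformations_iff)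

lemma deformation_classes_bijection:
  assumes x: "(\<delta>\<^sub>1, \<Lambda>\<^sub>1) \<in> deformations s G \<delta> \<mu> \<Lambda>"
  shows "\<exists>F. bij_betw F
      (tau_bar_cocycles s G \<delta> \<mu> \<Lambda> // tau_bar_cohomologous s G \<delta> \<mu> \<Lambda>)
      ({(\<delta>\<^sub>1', \<Lambda>\<^sub>1') \<in> deformations s G \<delta> \<mu> \<Lambda>. (\<delta>\<^sub>1, \<delta>\<^sub>1') \<in> delta_cohomologous s G \<delta>}
        // inf_equivalence s G \<delta> \<mu> \<Lambda>) \<and>
    (\<forall>\<tau> \<in> tau_cocycles s G \<delta> \<mu> \<Lambda>.
      F (tau_bar_cohomologous s G \<delta> \<mu> \<Lambda> `` {mu_class s G \<mu> 1 1 \<tau>}) =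
      inf_equivalence s G \<delta> \<mu> \<Lambda> `` {(\<delta>\<^sub>1, \<Lambda>\<^sub>1 + \<tau>)})"
proof -
  let ?D = "deformations s G \<delta> \<mu> \<Lambda>" and ?T = "tau_bar_cocycles s G \<delta> \<mu> \<Lambda>"
  let ?Q = "{(\<delta>\<^sub>1', \<Lambda>\<^sub>1') \<in> ?D. (\<delta>\<^sub>1, \<delta>\<^sub>1') \<in> delta_cohomologous s G \<delta>}"
  \<comment> \<open>The classes are singletons, and \<open>the_elem\<close> recovers \<tau> from its
    class.\<close>
  let ?f = "\<lambda>X. (\<delta>\<^sub>1, \<Lambda>\<^sub>1 + the_elem X)"
  have \<delta>\<^sub>1: "(\<delta>\<^sub>1, \<delta>\<^sub>1) \<in> delta_cohomologous s G \<delta>"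
    using x equiv_delta_cohomologous by (simp add: equiv_def refl_on_def mem_deformations_iff)
  have mem: "(\<delta>\<^sub>1, \<Lambda>\<^sub>1 + \<tau>) \<in> ?D \<longleftrightarrow> (0, \<tau>) \<in> ?D" for \<tau>
  proof
    assume "(0, \<tau>) \<in> ?D"
    \<comment> \<open>This is the base point plus \<open>(0, \<tau>)\<close>; the inner difference
      of the base point with itself supplies zero.\<close>
    then have "(\<delta>\<^sub>1, \<Lambda>\<^sub>1) - ((\<delta>\<^sub>1, \<Lambda>\<^sub>1) - (\<delta>\<^sub>1, \<Lambda>\<^sub>1) - (0, \<tau>)) \<in> ?D"
      using x by (intro deformations_diff)
    then show "(\<delta>\<^sub>1, \<Lambda>\<^sub>1 + \<tau>) \<in> ?D" by simp
  next
    assume "(\<delta>\<^sub>1, \<Lambda>\<^sub>1 + \<tau>) \<in> ?D"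
    then show "(0, \<tau>) \<in> ?D" using deformations_diff[OF _ x] by fastforce
  qed
  have singleton: thesis if "X \<in> ?T" "\<And>\<tau>. X = {\<tau>} \<Longrightarrow> (0, \<tau>) \<in> ?D \<Longrightarrow> thesis" for X thesis
    using that unfolding tau_bar_cocycles_eq by blast
  have "\<exists>F. bij_betw F (?T // tau_bar_cohomologous s G \<delta> \<mu> \<Lambda>) (?Q // inf_equivalence s G \<delta> \<mu> \<Lambda>) \<and>
      (\<forall>X\<in>?T. F (tau_bar_cohomologous s G \<delta> \<mu> \<Lambda> `` {X}) = inf_equivalence s G \<delta> \<mu> \<Lambda> `` {?f X})"
  proof (rule quotient_bijection[OF equiv_tau_bar_cohomologous equiv_inf_equivalence])
    show "?Q \<subseteq> ?D" by auto
    show "?f X \<in> ?Q" if "X \<in> ?T" for X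
    proof -
      obtain \<tau> where "X = {\<tau>}" "(0, \<tau>) \<in> ?D"
        using \<open>X \<in> ?T\<close> by (rule singleton)
      then show ?thesis using mem[of \<tau>] \<delta>\<^sub>1 by simp
    qed
    show "(X, Y) \<in> tau_bar_cohomologous s G \<delta> \<mu> \<Lambda> \<longleftrightarrow> (?f X, ?f Y) \<in> inf_equivalence s G \<delta> \<mu> \<Lambda>"
      if XY: "X \<in> ?T" "Y \<in> ?T" for X Y
    proof -
      obtain \<tau> where \<tau>: "X = {\<tau>}" "(0, \<tau>) \<in> ?D" by (rule singleton[OF XY(1)])
      obtain \<tau>' where "Y = {\<tau>'}" "(0, \<tau>') \<in> ?D" by (rule singleton[OF XY(2)])
      \<comment> \<open>The base point cancels: the images differ by
        \<open>(0, \<tau>' - \<tau>)\<close>.\<close>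
      with \<tau> show ?thesis
        using mem[of \<tau>] mem[of \<tau>']
        by (simp add: tau_bar_cohomologous_iff inf_equivalence_eq difference_relation_def)
    qed
    fix q assume "q \<in> ?Q"
    then obtain \<delta>\<^sub>1' \<Lambda>\<^sub>1' where q: "q = (\<delta>\<^sub>1', \<Lambda>\<^sub>1')" "(\<delta>\<^sub>1', \<Lambda>\<^sub>1') \<in> ?D" "(\<delta>\<^sub>1, \<delta>\<^sub>1') \<in> delta_cohomologous s G \<delta>"
      by auto
    then obtain b where b: "(\<delta>\<^sub>1' - \<delta>\<^sub>1, b) \<in> trivial_deformations"
      using deformation_translate[OF x] by blast
    \<comment> \<open>Chosen so that \<open>(\<delta>\<^sub>1, \<Lambda>\<^sub>1 + \<tau>)\<close>
      is \<open>q\<close> minus the trivial deformation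
      \<open>(\<delta>\<^sub>1' - \<delta>\<^sub>1, b)\<close>; it is then equivalent to
      \<open>q\<close> and lies over \<delta>\<open>\<^sub>1\<close> itself.\<close>
    define \<tau> where "\<tau> = \<Lambda>\<^sub>1' - b - \<Lambda>\<^sub>1"
    have "(\<delta>\<^sub>1', \<Lambda>\<^sub>1') - (\<delta>\<^sub>1' - \<delta>\<^sub>1, b) \<in> ?D"
      by (rule deformations_diff[OF q(2) subsetD[OF trivial_deformations_subset b]])
    then have "(\<delta>\<^sub>1, \<Lambda>\<^sub>1 + \<tau>) \<in> ?D" by (simp add: \<tau>_def)
    moreover have "(\<delta>\<^sub>1', \<Lambda>\<^sub>1') - (\<delta>\<^sub>1, \<Lambda>\<^sub>1 + \<tau>) \<in> trivial_deformations"
      using b by (simp add: \<tau>_def)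
    ultimately have "{\<tau>} \<in> ?T" "(?f {\<tau>}, q) \<in> inf_equivalence s G \<delta> \<mu> \<Lambda>"
      using mem[of \<tau>] q by (simp_all add: tau_bar_cocycles_eq inf_equivalence_eq difference_relation_def)
    then show "\<exists>X\<in>?T. (?f X, q) \<in> inf_equivalence s G \<delta> \<mu> \<Lambda>" by blast
  qed
  then show ?thesis
    by (elim ex_forward) (auto simp: tau_bar_cocycles_eq tau_cocycles_iff mu_class_singleton)
qed

end

lemma graded_sum_prod:
  fixes sM :: "'k::field \<Rightarrow> 'm::ab_group_add \<Rightarrow> 'm" and sW :: "'k \<Rightarrow> 'w::ab_group_add \<Rightarrow> 'w"
  assumes "(2::'k) \<noteq> 0" and M: "graded_vector_space sM GM" and W: "graded_vector_space sW GW"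
  shows "graded_sum (module_prod.scale sM sW) (sum_grading GM GW)"
proof -
  interpret M: graded_vector_space sM GM by fact
  interpret W: graded_vector_space sW GW by fact
  interpret V: graded_vector_space "module_prod.scale sM sW" "sum_grading GM GW"
    by (rule graded_vector_space_prod[OF M W])
  show ?thesis
    by unfold_locales (auto simp: assms(1) summand_def koszul_prod[OF M W] split: if_splits)
qed

theorem theorem10p1:
  fixes sM :: "'k::field \<Rightarrow> 'm::ab_group_add \<Rightarrow> 'm" and GM :: "bit \<Rightarrow> 'm set"
    and sW :: "'k \<Rightarrow> 'w::ab_group_add \<Rightarrow> 'w" and GW :: "bit \<Rightarrow> 'w set"
    and s :: "'k \<Rightarrow> 'm \<times> 'w \<Rightarrow> 'm \<times> 'w" and G :: "bit \<Rightarrow> ('m \<times> 'w) set"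
    and \<delta> \<mu> \<Lambda> :: "('m \<times> 'w) cochain"
  assumes char: "(2::'k) \<noteq> 0" "(3::'k) \<noteq> 0"
    and M: "graded_vector_space sM GM" and W: "graded_vector_space sW GW"
    and V: "s = module_prod.scale sM sW" "G = sum_grading GM GW"
    and \<delta>: "\<delta> \<in> CW s 2" "odd_cochain G \<delta>"
    and \<mu>: "\<mu> \<in> CM s 2 0" "odd_cochain G \<mu>"
    and \<Lambda>: "\<Lambda> \<in> CM s 1 1" "odd_cochain G \<Lambda>"
    and associative: "bracket s G \<delta> \<delta> = 0" "bracket s G \<mu> \<mu> = 0"
    and "module": "bracket s G \<delta> \<Lambda> + (\<lambda>vs. s (1/2) (bracket s G \<Lambda> \<Lambda> vs)) = 0"
    and compatible: "bracket s G \<mu> \<Lambda> = 0"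
  shows "equiv (deformations s G \<delta> \<mu> \<Lambda>) (inf_equivalence s G \<delta> \<mu> \<Lambda>) \<and>
    equiv (delta_cocycles s G \<delta>) (delta_cohomologous s G \<delta>) \<and>
    equiv (tau_bar_cocycles s G \<delta> \<mu> \<Lambda>) (tau_bar_cohomologous s G \<delta> \<mu> \<Lambda>) \<and>
    (\<forall>((\<delta>\<^sub>1, \<Lambda>\<^sub>1), (\<delta>\<^sub>1', \<Lambda>\<^sub>1')) \<in> inf_equivalence s G \<delta> \<mu> \<Lambda>.
           (\<delta>\<^sub>1, \<delta>\<^sub>1') \<in> delta_cohomologous s G \<delta>) \<and>
    (\<forall>\<delta>\<^sub>1 \<in> delta_cocycles s G \<delta>.
           (\<exists>\<Lambda>\<^sub>1. (\<delta>\<^sub>1, \<Lambda>\<^sub>1) \<in> deformations s G \<delta> \<mu> \<Lambda>) \<longleftrightarrow> obstruction_vanishes s G \<delta> \<mu> \<Lambda> \<delta>\<^sub>1) \<and>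
    (\<forall>(\<delta>\<^sub>1, \<delta>\<^sub>1') \<in> delta_cohomologous s G \<delta>.
           obstruction_vanishes s G \<delta> \<mu> \<Lambda> \<delta>\<^sub>1 \<longleftrightarrow> obstruction_vanishes s G \<delta> \<mu> \<Lambda> \<delta>\<^sub>1') \<and>
    (\<forall>(\<delta>\<^sub>1, \<Lambda>\<^sub>1) \<in> deformations s G \<delta> \<mu> \<Lambda>.
       \<exists>F. bij_betw F
             (tau_bar_cocycles s G \<delta> \<mu> \<Lambda> // tau_bar_cohomologous s G \<delta> \<mu> \<Lambda>)
             ({(\<delta>\<^sub>1', \<Lambda>\<^sub>1') \<in> deformations s G \<delta> \<mu> \<Lambda>. (\<delta>\<^sub>1, \<delta>\<^sub>1') \<in> delta_cohomologous s G \<delta>}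
                // inf_equivalence s G \<delta> \<mu> \<Lambda>) \<and>
           (\<forall>\<tau> \<in> tau_cocycles s G \<delta> \<mu> \<Lambda>.
              F (tau_bar_cohomologous s G \<delta> \<mu> \<Lambda> `` {mu_class s G \<mu> 1 1 \<tau>}) =
              inf_equivalence s G \<delta> \<mu> \<Lambda> `` {(\<delta>\<^sub>1, \<Lambda>\<^sub>1 + \<tau>)}))"
proof -
  interpret extension s G \<delta> \<mu> \<Lambda>
    unfolding extension_def extension_axioms_def
    using graded_sum_prod[OF char(1) M W] \<delta> \<mu> \<Lambda> associative "module" compatible
    by (simp only: V simp_thms)
  show ?thesis
  proof (intro conjI ballI)
    fix x assume "x \<in> inf_equivalence s G \<delta> \<mu> \<Lambda>"
    then show "case x of (x, y) \<Rightarrow> (case x of (\<delta>\<^sub>1, \<Lambda>\<^sub>1) \<Rightarrow> \<lambda>(\<delta>\<^sub>1', \<Lambda>\<^sub>1').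
        (\<delta>\<^sub>1, \<delta>\<^sub>1') \<in> delta_cohomologous s G \<delta>) y"
      using inf_equivalence_delta_cohomologous by (cases x) auto
  next
    fix x assume "x \<in> delta_cohomologous s G \<delta>"
    then show "case x of (\<delta>\<^sub>1, \<delta>\<^sub>1') \<Rightarrow>
        obstruction_vanishes s G \<delta> \<mu> \<Lambda> \<delta>\<^sub>1 \<longleftrightarrow> obstruction_vanishes s G \<delta> \<mu> \<Lambda> \<delta>\<^sub>1'"
      using obstruction_vanishes_cong by (cases x) simp
  next
    fix x assume "x \<in> deformations s G \<delta> \<mu> \<Lambda>"
    then show "case x of (\<delta>\<^sub>1, \<Lambda>\<^sub>1) \<Rightarrow> \<exists>F. bij_betw F
         (tau_bar_cocycles s G \<delta> \<mu> \<Lambda> // tau_bar_cohomologous s G \<delta> \<mu> \<Lambda>)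
         ({(\<delta>\<^sub>1', \<Lambda>\<^sub>1') \<in> deformations s G \<delta> \<mu> \<Lambda>. (\<delta>\<^sub>1, \<delta>\<^sub>1') \<in> delta_cohomologous s G \<delta>}
            // inf_equivalence s G \<delta> \<mu> \<Lambda>) \<and>
       (\<forall>\<tau> \<in> tau_cocycles s G \<delta> \<mu> \<Lambda>.
          F (tau_bar_cohomologous s G \<delta> \<mu> \<Lambda> `` {mu_class s G \<mu> 1 1 \<tau>}) =
          inf_equivalence s G \<delta> \<mu> \<Lambda> `` {(\<delta>\<^sub>1, \<Lambda>\<^sub>1 + \<tau>)})"
      using deformation_classes_bijection by (cases x) (simp only: prod.case)
  qed (simp_all only: obstruction_vanishes_iff equiv_inf_equivalence equiv_delta_cohomologous
      equiv_tau_bar_cohomologous)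
qed

end
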